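(* Let (S) denote the Hamiltonian system $\frac{dx}{dt}=\frac{\partial H}{\partial y}$, $\frac{dy}{dt}=-\frac{\partial H}{\partial x}$, $\frac{dz}{dt}=\frac{\partial H}{\partial w}$, $\frac{dw}{dt}=-\frac{\partial H}{\partial z}$ with polynomial Hamiltonian \begin{align*} H=&\ \tilde H_{VI}(x,y,t;2\alpha_0+\alpha_1,\alpha_1,\alpha_2,\alpha_3+\alpha_5+2\alpha_6,\alpha_3+2\alpha_4+\alpha_5)\\ &+\tilde H_{VI}(z,w,t;2\alpha_0+\alpha_1+2\alpha_2+\alpha_3,\alpha_1+\alpha_3,\alpha_4,\alpha_5+2\alpha_6,\alpha_5)+\frac{2x\{(tx-1)y+t\alpha_2\}(z-1)w}{t(t-1)}, \end{align*} where $\alpha_0,\dots,\alpha_6\in\mathbb{C}$ satisfy $\alpha_0+\alpha_1+\alpha_2+\alpha_3+\alpha_4+\alpha_5+\alpha_6=\frac12$. Then (S) admits extended affine Weyl group symmetry of type $D_7^{(2)}$ as the group of its Bäcklund transformations, whose generators $u_0,\dots,u_6,\phi$ are given as follows, with $( * )=(x,y,z,w,t;\alpha_0,\dots,\alpha_6)$: \begin{align*} u_0:( * )&\to\Big(\tfrac{tx-1}{t-1},\tfrac{(t-1)y}{t},\tfrac{tz-1}{t-1},\tfrac{(t-1)w}{t},1-t;-\alpha_0,\alpha_1+2\alpha_0,\alpha_2,\alpha_3,\alpha_4,\alpha_5,\alpha_6\Big),\\ u_1:( * )&\to\left(x,y-\tfrac{\alpha_1}{x},z,w,t;\alpha_0+\alpha_1,-\alpha_1,\alpha_2+\alpha_1,\alpha_3,\alpha_4,\alpha_5,\alpha_6\right),\\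 u_2:( * )&\to\left(x+\tfrac{\alpha_2}{y},y,z,w,t;\alpha_0,\alpha_1+\alpha_2,-\alpha_2,\alpha_3+\alpha_2,\alpha_4,\alpha_5,\alpha_6\right),\\ u_3:( * )&\to\left(x,y-\tfrac{\alpha_3}{x-z},z,w+\tfrac{\alpha_3}{x-z},t;\alpha_0,\alpha_1,\alpha_2+\alpha_3,-\alpha_3,\alpha_4+\alpha_3,\alpha_5,\alpha_6\right),\\ u_4:( * )&\to\left(x,y,z+\tfrac{\alpha_4}{w},w,t;\alpha_0,\alpha_1,\alpha_2,\alpha_3+\alpha_4,-\alpha_4,\alpha_5+\alpha_4,\alpha_6\right),\\ u_5:( * )&\to(x,y,z,w,t;\alpha_0,\alpha_1,\alpha_2,\alpha_3,\alpha_4+\alpha_5,-\alpha_5,\alpha_6+\alpha_5),\\ u_6:( * )&\to\Big(\tfrac{x}{x-1},-(x-1)\{(x-1)y+\alpha_2\},\tfrac{z}{z-1},-(z-1)\{(z-1)w+\alpha_4\},1-t;\\ &\qquad\alpha_0,\alpha_1,\alpha_2,\alpha_3,\alpha_4,\alpha_5+2\alpha_6,-\alpha_6\Big),\\ \phi:( * )&\to\left(\tfrac{1}{tz},-tz(zw+\alpha_4),\tfrac{1}{tx},-tx(xy+\alpha_2),t;\alpha_6,\alpha_5,\alpha_4,\alpha_3,\alpha_2,\alpha_1,\alpha_0\right). \end{align*}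
   Context: For parameters with $\delta_0+\delta_1+2\delta_2+\delta_3+\delta_4=1$, $$\tilde H_{VI}(Q,P,t;\delta_0,\dots,\delta_4)=\tfrac{1}{t(t-1)}\big[P^2(tQ-1)(Q-1)Q-\{(\delta_0-1)t(Q-1)Q+\delta_1(Q-1)(tQ-1)+\delta_3Q(tQ-1)\}P+\delta_2(\delta_2+\delta_4)tQ\big].$$ A Bäcklund transformation is a birational change of $(x,y,z,w,t)$ (depending on the parameters) together with a change of parameters that carries the system with the old parameters into the system with the new parameters (in the new variables, with the new independent variable). Transformations are composed as substitution automorphisms of the field of rational functions in $x,y,z,w,t$ and the parameters. "Extended affine Weyl group symmetry of type $D_7^{(2)}$" means: all the transformations are Bäcklund transformations; $u_i^2=1$ and $(u_iu_j)^{m_{ij}}=1$ with $m_{01}=m_{56}=4$, $m_{12}=m_{23}=m_{34}=m_{45}=3$ and $m_{ij}=2$ for other pairs $i\neq j$ (Dynkin diagram of type $D_7^{(2)}$); and $\phi$ acts as the diagram automorphism: $\phi^2=1$ and conjugation by $\phi$ maps $u_i$ to $u_{6-i}$. *)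

theory Defs
  imports "HOL-Analysis.Analysis" "HOL-Library.Poly_Mapping"
    "HOL-Computational_Algebra.Fraction_Field"
begin

(* The parameters satisfy alpha_0 + ... + alpha_6 = 1/2, so alpha_0, ..., alpha_5 serve as
   independent variables and alpha_6 is defined from them below (par 6).
   The linear order is only needed for the library's proof that the polynomials over
   these variables form an integral domain. *)
datatype coord = CX | CY | CZ | CW | CT | CA0 | CA1 | CA2 | CA3 | CA4 | CA5

fun coord_rank :: "coord \<Rightarrow> nat" where
  "coord_rank CX = 0" | "coord_rank CY = 1" | "coord_rank CZ = 2" | "coord_rank CW = 3"
| "coord_rank CT = 4" | "coord_rank CA0 = 5" | "coord_rank CA1 = 6" | "coord_rank CA2 = 7"
| "coord_rank CA3 = 8" | "coord_rank CA4 = 9" | "coord_rank CA5 = 10"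

lemma coord_rank_inject: "coord_rank a = coord_rank b \<longleftrightarrow> a = b"
  by (cases a; cases b) simp_all

instantiation coord :: linorder
begin
definition less_eq_coord :: "coord \<Rightarrow> coord \<Rightarrow> bool"
  where "a \<le> b \<longleftrightarrow> coord_rank a \<le> coord_rank b"
definition less_coord :: "coord \<Rightarrow> coord \<Rightarrow> bool"
  where "a < b \<longleftrightarrow> coord_rank a < coord_rank b"
instance
  by standard (auto simp: less_eq_coord_def less_coord_def coord_rank_inject)
end

type_synonym cpoly = "(coord \<Rightarrow>\<^sub>0 nat) \<Rightarrow>\<^sub>0 complex"
type_synonym ratfun = "cpoly fract"

definition rconst :: "complex \<Rightarrow> ratfun"
  where "rconst c = Fract (Poly_Mapping.single 0 c) 1"

definition rvar :: "coord \<Rightarrow> ratfun"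
  where "rvar v = Fract (Poly_Mapping.single (Poly_Mapping.single v 1) 1) 1"

definition par :: "nat \<Rightarrow> ratfun" (\<open>\<^bold>\<alpha>\<close>)
  where "par i =
    (if i = 0 then rvar CA0 else if i = 1 then rvar CA1 else if i = 2 then rvar CA2
     else if i = 3 then rvar CA3 else if i = 4 then rvar CA4 else if i = 5 then rvar CA5
     else rconst (1/2) - (rvar CA0 + rvar CA1 + rvar CA2 + rvar CA3 + rvar CA4 + rvar CA5))"

abbreviation rat_x :: ratfun (\<open>\<^bold>x\<close>) where "\<^bold>x \<equiv> rvar CX"
abbreviation rat_y :: ratfun (\<open>\<^bold>y\<close>) where "\<^bold>y \<equiv> rvar CY"
abbreviation rat_z :: ratfun (\<open>\<^bold>z\<close>) where "\<^bold>z \<equiv> rvar CZ"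
abbreviation rat_w :: ratfun (\<open>\<^bold>w\<close>) where "\<^bold>w \<equiv> rvar CW"
abbreviation rat_t :: ratfun (\<open>\<^bold>t\<close>) where "\<^bold>t \<equiv> rvar CT"

definition poly_eval :: "(coord \<Rightarrow> complex) \<Rightarrow> cpoly \<Rightarrow> complex"
  where "poly_eval p f = (\<Sum>m\<in>Poly_Mapping.keys f.
    Poly_Mapping.lookup f m * (\<Prod>v\<in>Poly_Mapping.keys m. p v ^ Poly_Mapping.lookup m v))"

(* f is regular at the point p, with value c.  Some fraction representing f must have a
   denominator that does not vanish at p; c does not depend on which one is taken. *)
definition has_value :: "ratfun \<Rightarrow> (coord \<Rightarrow> complex) \<Rightarrow> complex \<Rightarrow> bool"
  where "has_value f p c \<longleftrightarrow>
    (\<exists>n d. f = Fract n d \<and> poly_eval p d \<noteq> 0 \<and> c = poly_eval p n / poly_eval p d)"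

fun point :: "complex \<Rightarrow> complex \<Rightarrow> complex \<Rightarrow> complex \<Rightarrow> complex \<Rightarrow> (nat \<Rightarrow> complex)
    \<Rightarrow> coord \<Rightarrow> complex" where
  "point x y z w t a CX = x" | "point x y z w t a CY = y" | "point x y z w t a CZ = z"
| "point x y z w t a CW = w" | "point x y z w t a CT = t"
| "point x y z w t a CA0 = a 0" | "point x y z w t a CA1 = a 1" | "point x y z w t a CA2 = a 2"
| "point x y z w t a CA3 = a 3" | "point x y z w t a CA4 = a 4" | "point x y z w t a CA5 = a 5"

(* The subfield of rational functions of the parameters alone. *)
definition par_poly :: "cpoly \<Rightarrow> bool"
  where "par_poly f \<longleftrightarrow>
    (\<forall>m\<in>Poly_Mapping.keys f. Poly_Mapping.keys m \<subseteq> {CA0, CA1, CA2, CA3, CA4, CA5})"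

definition par_field :: "ratfun set"
  where "par_field = {Fract n d | n d. d \<noteq> 0 \<and> par_poly n \<and> par_poly d}"

definition field_automorphism :: "(ratfun \<Rightarrow> ratfun) \<Rightarrow> bool"
  where "field_automorphism s \<longleftrightarrow> bij s \<and>
    (\<forall>f g. s (f + g) = s f + s g) \<and> (\<forall>f g. s (f * g) = s f * s g) \<and>
    (\<forall>c. s (rconst c) = rconst c)"

definition HVI :: "complex \<Rightarrow> complex \<Rightarrow> complex \<Rightarrow> complex \<Rightarrow> complex \<Rightarrow> complex \<Rightarrow> complex
    \<Rightarrow> complex \<Rightarrow> complex"
  where "HVI Q P t d0 d1 d2 d3 d4 = 1 / (t * (t - 1)) *
    (P^2 * (t * Q - 1) * (Q - 1) * Q
     - ((d0 - 1) * t * (Q - 1) * Q + d1 * (Q - 1) * (t * Q - 1) + d3 * Q * (t * Q - 1)) * P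
     + d2 * (d2 + d4) * t * Q)"

definition Ham :: "(nat \<Rightarrow> complex) \<Rightarrow> complex \<Rightarrow> complex \<Rightarrow> complex \<Rightarrow> complex \<Rightarrow> complex \<Rightarrow> complex"
  where "Ham a x y z w t =
    HVI x y t (2 * a 0 + a 1) (a 1) (a 2) (a 3 + a 5 + 2 * a 6) (a 3 + 2 * a 4 + a 5)
    + HVI z w t (2 * a 0 + a 1 + 2 * a 2 + a 3) (a 1 + a 3) (a 4) (a 5 + 2 * a 6) (a 5)
    + 2 * x * ((t * x - 1) * y + t * a 2) * (z - 1) * w / (t * (t - 1))"

(* A solution of the Hamiltonian system with parameters a, along a curve s |-> T s of the
   independent variable with nonvanishing derivative: dX/dT is (dX/ds) / (dT/ds), so the
   equation dX/dT = dH/dY reads dX/ds = dT/ds * dH/dY.  With T s = s this is the system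
   itself on the open set U. *)
definition is_solution :: "(nat \<Rightarrow> complex) \<Rightarrow> complex set \<Rightarrow> (complex \<Rightarrow> complex) \<Rightarrow> (complex \<Rightarrow> complex)
    \<Rightarrow> (complex \<Rightarrow> complex) \<Rightarrow> (complex \<Rightarrow> complex) \<Rightarrow> (complex \<Rightarrow> complex) \<Rightarrow> bool"
  where "is_solution a U X Y Z W T \<longleftrightarrow> open U \<and>
    (\<forall>s\<in>U. T s \<noteq> 0 \<and> T s \<noteq> 1 \<and>
      (\<exists>T'. T' \<noteq> 0 \<and> (T has_field_derivative T') (at s) \<and>
        (X has_field_derivative
          T' * deriv (\<lambda>v. Ham a (X s) v (Z s) (W s) (T s)) (Y s)) (at s) \<and>
        (Y has_field_derivative
          T' * (- deriv (\<lambda>v. Ham a v (Y s) (Z s) (W s) (T s)) (X s))) (at s) \<and>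
        (Z has_field_derivative
          T' * deriv (\<lambda>v. Ham a (X s) (Y s) (Z s) v (T s)) (W s)) (at s) \<and>
        (W has_field_derivative
          T' * (- deriv (\<lambda>v. Ham a (X s) (Y s) v (W s) (T s)) (Z s))) (at s)))"

(* s is a birational change of (x,y,z,w,t) depending on the parameters, together with a change
   of the parameters.  For all complex parameter values a, wherever the transformed quantities
   are defined along a solution for a, they solve the system for the transformed values b. *)
definition baecklund :: "(ratfun \<Rightarrow> ratfun) \<Rightarrow> bool"
  where "baecklund s \<longleftrightarrow> field_automorphism s \<and> s ` par_field = par_field \<and>
    (\<forall>a b U x y z w X Y Z W T.
      (\<Sum>i\<le>6. a i) = 1/2 \<and> is_solution a U x y z w (\<lambda>t. t) \<and>
      (\<forall>t\<in>U. let p = point (x t) (y t) (z t) (w t) t a in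
        has_value (s \<^bold>x) p (X t) \<and> has_value (s \<^bold>y) p (Y t) \<and>
        has_value (s \<^bold>z) p (Z t) \<and> has_value (s \<^bold>w) p (W t) \<and>
        has_value (s \<^bold>t) p (T t) \<and> (\<forall>i\<le>6. has_value (s (\<^bold>\<alpha> i)) p (b i)))
      \<longrightarrow> is_solution b U X Y Z W T)"

definition images :: "(ratfun \<Rightarrow> ratfun) \<Rightarrow> ratfun \<times> ratfun \<times> ratfun \<times> ratfun \<times> ratfun \<times> ratfun list"
  where "images s = (s \<^bold>x, s \<^bold>y, s \<^bold>z, s \<^bold>w, s \<^bold>t, map (\<lambda>i. s (\<^bold>\<alpha> i)) [0..<7])"

definition coxeter_D72 :: "nat \<Rightarrow> nat \<Rightarrow> nat"
  where "coxeter_D72 i j =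
    (if {i, j} = {0, 1} \<or> {i, j} = {5, 6} then 4
     else if i = Suc j \<or> j = Suc i then 3 else 2)"

end

theory Submission
  imports Defs
begin

text \<open>
  A substitution of rational functions extends to the field of rational functions as soon as it is
  injective on polynomials. For a formally involutive substitution this is automatic: substituting
  once more into the image of a polynomial \<open>f\<close> recovers \<open>f\<close>. So each generator is an involutive
  automorphism, and since two homomorphisms that agree on the variables coincide, the Coxeter
  relations are finitely many identities between rational functions. The diagram automorphism \<open>\<phi>\<close>
  conjugates \<open>u\<^sub>i\<close> to \<open>u\<^sub>6\<^sub>-\<^sub>i\<close>, which leaves only half of them to be verified.

  That the Hamiltonian system is preserved follows from the chain rule and an identity between
  rational functions for every generator. These become polynomial identities when each correction
  term such as \<open>\<alpha>\<^sub>1 / x\<close> is taken as a new variable \<open>k\<close>, with \<open>\<alpha>\<^sub>1 = k x\<close>.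
\<close>

text \<open>Three obstacles shape the argument. First, a transformed quantity is regular at a point
  when some fraction representing it has a nonvanishing denominator there, and the parameters are
  variables of that fraction. So \<open>y - \<alpha> 1 / x\<close> is singular at
  \<open>x = 0\<close> even along a solution with \<open>\<alpha> 1 = 0\<close>, and this is seen
  only by leaving the given parameter value. Once such points are excluded, the closed formulas for
  the transformed curves are valid for all parameter values. Second, composites of generators have
  denominators that occur in no single generator. Each of them is, up to nonzero factors, the image
  of a nonzero element under a field homomorphism and therefore cannot vanish. Third, evaluation at
  a complex point and substitution of rational functions are both partial: each is a ring
  homomorphism from polynomials to a field, extended to those fractions that have a denominator
  outside its kernel. One relation \<open>val\<close> covers both, and substitution becomes total
  exactly when the kernel is trivial.\<close>

instance coord :: finite
proof
  have "(UNIV :: coord set) = {CX, CY, CZ, CW, CT, CA0, CA1, CA2, CA3, CA4, CA5}"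
    using coord.exhaust by auto
  then show "finite (UNIV :: coord set)"
    by (metis finite.emptyI finite_insert)
qed

section \<open>Induction principles for polynomials\<close>

lemma poly_mapping_sum_induct [case_names zero single add]:
  fixes f :: "'a \<Rightarrow>\<^sub>0 'b::comm_monoid_add"
  assumes "P 0" and "\<And>m c. P (Poly_Mapping.single m c)" and "\<And>f g. P f \<Longrightarrow> P g \<Longrightarrow> P (f + g)"
  shows "P f"
proof (induction f rule: update_induct)
  case (update f a b)
  have "Poly_Mapping.update a b f = Poly_Mapping.single a b + f"
    using update(1)
    by (intro poly_mapping_eqI)
      (auto simp: lookup_update lookup_add lookup_single when_def in_keys_iff)
  then show ?case using update assms by simp
qed (use assms in simp)

text \<open>Exponent vectors are themselves finitely supported functions, so the induction over sums
  is used twice: for the polynomial, and inside it for the exponents of a monomial, where sums of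
  exponents become products of monomials.\<close>

lemma cpoly_induct [case_names const var add mult]:
  fixes f :: cpoly
  assumes const: "\<And>c. P (Poly_Mapping.single 0 c)"
    and var: "\<And>v. P (Poly_Mapping.single (Poly_Mapping.single v 1) 1)"
    and add: "\<And>f g. P f \<Longrightarrow> P g \<Longrightarrow> P (f + g)"
    and mult: "\<And>f g. P f \<Longrightarrow> P g \<Longrightarrow> P (f * g)"
  shows "P f"
proof (induction f rule: poly_mapping_sum_induct)
  case zero
  show ?case using const[of 0] by simp
next
  case (single m c)
  have "P (Poly_Mapping.single m 1)"
  proof (induction m rule: poly_mapping_sum_induct)
    case (single v k)
    show ?case
    proof (induction k)
      case 0
      show ?case using const[of 1] by simp
    next
      case (Suc k)
      have "Poly_Mapping.single (Poly_Mapping.single v (Suc k)) (1::complex) =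
          Poly_Mapping.single (Poly_Mapping.single v 1) 1 * Poly_Mapping.single (Poly_Mapping.single
              v k) 1"
        by (simp add: mult_single flip: single_add)
      then show ?case using mult[OF var Suc] by simp
    qed
  next
    case (add f g)
    then show ?case using mult[of "Poly_Mapping.single f 1" "Poly_Mapping.single g 1"]
      by (simp add: mult_single)
  qed (use const[of 1] in simp)
  then show ?case
    using mult[OF const[of c], of "Poly_Mapping.single m 1"] by (simp add: mult_single)
qed (rule add)

subsection \<open>Evaluation of polynomials and rational functions\<close>

text \<open>Coefficients pass through an embedding \<open>c\<close>, so that evaluation at complex
  points and substitution of rational functions share one theory.\<close>

definition peval :: "(complex \<Rightarrow> 'a::field) \<Rightarrow> (coord \<Rightarrow> 'a) \<Rightarrow> cpoly \<Rightarrow> 'a"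
  where "peval c g f = (\<Sum>m\<in>Poly_Mapping.keys f. c (Poly_Mapping.lookup f m) *
    (\<Prod>v\<in>Poly_Mapping.keys m. g v ^ Poly_Mapping.lookup m v))"

lemma poly_eval_conv_peval: "poly_eval p = peval (\<lambda>x. x) p"
  by (simp add: fun_eq_iff poly_eval_def peval_def)

text \<open>A ring homomorphism from polynomials into a field. Its kernel may be nonzero, which is
  why its extension to fractions is a relation rather than a function.\<close>

locale poly_hom =
  fixes e :: "cpoly \<Rightarrow> 'a::field"
  assumes hom_add: "e (f + g) = e f + e g"
    and hom_mult: "e (f * g) = e f * e g"
    and hom_one: "e 1 = 1"
begin

lemma hom_zero: "e 0 = 0"
  using hom_add[of 0 0] by (metis add_0 add_cancel_right_right)

lemma hom_minus: "e (- f) = - e f"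
  using hom_add[of f "- f"] hom_zero by (simp add: eq_neg_iff_add_eq_0 add.commute)

text \<open>The target field may be \<open>complex\<close>, which gives \<^const>\<open>has_value\<close>, or \<open>ratfun\<close> itself, which gives
    substitution.\<close>

definition val :: "ratfun \<Rightarrow> 'a \<Rightarrow> bool"
  where "val f c \<longleftrightarrow> (\<exists>n d. f = Fract n d \<and> e d \<noteq> 0 \<and> c = e n / e d)"

lemma valE:
  assumes "val f c"
  obtains n d where "f = Fract n d" "d \<noteq> 0" "e d \<noteq> 0" "c = e n / e d"
  using assms hom_zero by (force simp: val_def)

text \<open>Two representations of one fraction cross-multiply to the same polynomial;
  \<open>e\<close> carries this equation to the field, where both denominators are nonzero.\<close>

lemma val_unique:
  assumes "val f c" "val f c'"
  shows "c = c'"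
proof -
  obtain n d where 1: "f = Fract n d" "d \<noteq> 0" "e d \<noteq> 0" "c = e n / e d"
    using assms(1) by (rule valE)
  obtain n' d' where 2: "f = Fract n' d'" "d' \<noteq> 0" "e d' \<noteq> 0" "c' = e n' / e d'"
    using assms(2) by (rule valE)
  have "n * d' = n' * d"
    using 1 2 by (simp add: eq_fract)
  then have "e n * e d' = e n' * e d"
    by (simp flip: hom_mult)
  then show ?thesis
    using 1 2 by (simp add: frac_eq_eq)
qed

lemma val_poly: "val (Fract f 1) (e f)"
  unfolding val_def using hom_one by (intro exI[of _ f] exI[of _ 1]) simp

lemma val_add:
  assumes "val f a" "val g b"
  shows "val (f + g) (a + b)"
proof -
  obtain n d where 1: "f = Fract n d" "d \<noteq> 0" "e d \<noteq> 0" "a = e n / e d"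
    using assms(1) by (rule valE)
  obtain n' d' where 2: "g = Fract n' d'" "d' \<noteq> 0" "e d' \<noteq> 0" "b = e n' / e d'"
    using assms(2) by (rule valE)
  have "f + g = Fract (n * d' + n' * d) (d * d')"
    using 1 2 by simp
  moreover have "a + b = e (n * d' + n' * d) / e (d * d')"
    unfolding hom_add hom_mult 1(4) 2(4) by (rule add_frac_eq[OF 1(3) 2(3)])
  moreover have "e (d * d') \<noteq> 0"
    using 1 2 by (simp only: hom_mult) simp
  ultimately show ?thesis
    unfolding val_def by blast
qed

lemma val_mult: "val f a \<Longrightarrow> val g b \<Longrightarrow> val (f * g) (a * b)"
  by (elim valE, unfold val_def)
    (rule exI, rule exI, rule conjI, simp only: mult_fract, simp add: hom_mult)

lemma val_minus: "val f a \<Longrightarrow> val (- f) (- a)"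
  by (elim valE, unfold val_def)
    (rule exI, rule exI, rule conjI, simp only: minus_fract, simp add: hom_minus)

lemma val_inverse: "val f a \<Longrightarrow> a \<noteq> 0 \<Longrightarrow> val (inverse f) (inverse a)"
  by (elim valE, unfold val_def)
    (rule exI, rule exI, rule conjI, simp only: inverse_fract, simp)

lemma val_diff: "val f a \<Longrightarrow> val g b \<Longrightarrow> val (f - g) (a - b)"
  using val_add[of f a "- g" "- b"] val_minus[of g b] by simp

lemma val_divide: "val f a \<Longrightarrow> val g b \<Longrightarrow> b \<noteq> 0 \<Longrightarrow> val (f / g) (a / b)"
  using val_mult[of f a "inverse g" "inverse b"] val_inverse[of g b] by (simp add: divide_inverse)

lemma val_0: "val 0 0"
  using val_poly[of 0] by (simp add: hom_zero fract_collapse)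

lemma val_1: "val 1 1"
  using val_poly[of 1] by (simp add: hom_one fract_collapse)

lemma val_numeral: "val (numeral n) (numeral n)"
proof -
  have "val (of_nat k) (of_nat k)" for k
    by (induction k) (simp_all add: val_0 val_add val_1)
  from this[of "numeral n"] show ?thesis by simp
qed

lemmas val_intros = val_add val_mult val_minus val_diff val_divide val_0 val_1 val_numeral

end

locale const_hom =
  fixes c :: "complex \<Rightarrow> 'a::field"
  assumes const_add: "c (a + b) = c a + c b"
    and const_mult: "c (a * b) = c a * c b"
    and const_one: "c 1 = 1"
begin

lemma const_zero: "c 0 = 0"
  using const_add[of 0 0] by (metis add_0 add_cancel_right_right)

lemma peval_add: "peval c g (f + h) = peval c g f + peval c g h"
  unfolding peval_def
  by (rule setsum_keys_plus_distrib) (simp_all add: const_zero const_add distrib_right)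

text \<open>As there are finitely many variables, a monomial can be evaluated over all of them, so
  exponents of a product add without any bookkeeping of supports.\<close>

lemma peval_single: "peval c g (Poly_Mapping.single m a) =
  c a * (\<Prod>v\<in>UNIV. g v ^ Poly_Mapping.lookup m v)"
proof -
  have "(\<Prod>v\<in>Poly_Mapping.keys m. g v ^ Poly_Mapping.lookup m v) =
      (\<Prod>v\<in>UNIV. g v ^ Poly_Mapping.lookup m v)"
    by (rule prod.mono_neutral_left) (auto simp: in_keys_iff)
  then show ?thesis
    by (simp add: peval_def const_zero)
qed

lemma peval_zero: "peval c g 0 = 0"
  by (simp add: peval_def)

text \<open>Both sides are additive in each factor, which reduces the claim to two
  monomials.\<close>

lemma peval_mult: "peval c g (f * h) = peval c g f * peval c g h"
proof (induction f rule: poly_mapping_sum_induct)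
  case (single m a)
  show ?case
  proof (induction h rule: poly_mapping_sum_induct)
    case (single n b)
    then show ?case
      by (simp add: mult_single peval_single const_mult lookup_add power_add prod.distrib)
  qed (simp_all add: peval_zero peval_add algebra_simps)
qed (simp_all add: peval_zero peval_add algebra_simps)

sublocale peval: poly_hom "peval c g" for g
proof
  show "peval c g 1 = 1"
    by (simp add: peval_def const_one)
qed (fact peval_add peval_mult)+

lemma peval_const: "peval c g (Poly_Mapping.single 0 a) = c a"
  by (simp add: peval_single)

lemma peval_var: "peval c g (Poly_Mapping.single (Poly_Mapping.single v 1) 1) = g v"
proof -
  have "(\<Prod>w\<in>UNIV. g w ^ Poly_Mapping.lookup (Poly_Mapping.single v 1) w) = (\<Prod>w\<in>{v}. g w)"
    by (rule prod.mono_neutral_cong_right) (auto simp: lookup_single when_def)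
  then show ?thesis
    by (simp add: peval_single const_one)
qed

lemma val_rconst: "peval.val g (rconst a) (c a)"
  using peval.val_poly[of g "Poly_Mapping.single 0 a"] by (simp add: rconst_def peval_const)

lemma val_rvar: "peval.val g (rvar v) (g v)"
  using peval.val_poly[of g "Poly_Mapping.single (Poly_Mapping.single v 1) 1"]
  by (simp only: rvar_def peval_var)

end

interpretation complex_const: const_hom "\<lambda>x :: complex. x"
  by standard auto

lemma has_value_conv_val: "has_value f p c \<longleftrightarrow> complex_const.peval.val p f c"
  by (simp add: has_value_def complex_const.peval.val_def poly_eval_conv_peval)

interpretation rconst: const_hom rconst
  by standard (simp_all add: rconst_def single_add mult_single fract_collapse)

text \<open>A polynomial is its own value at the generic point, the tuple of variables.\<close>

lemma Fract_conv_peval: "Fract f 1 = peval rconst rvar f"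
proof (induction f rule: cpoly_induct)
  case (const c)
  show ?case by (simp only: rconst.peval_const) (simp only: rconst_def)
next
  case (var v)
  then show ?case by (simp only: rconst.peval_var) (simp only: rvar_def)
next
  case (add f g)
  then show ?case by (simp add: rconst.peval_add flip: add)
next
  case (mult f g)
  then show ?case by (simp add: rconst.peval_mult flip: mult)
qed

section \<open>Extension of a substitution to the field of rational functions\<close>

definition ext :: "(coord \<Rightarrow> ratfun) \<Rightarrow> ratfun \<Rightarrow> ratfun"
  where "ext g f = (THE c. rconst.peval.val g f c)"

lemma ext_eqI: "rconst.peval.val g f c \<Longrightarrow> ext g f = c"
  unfolding ext_def using rconst.peval.val_unique by blast

text \<open>Involutivity is phrased with \<open>val\<close>, not with \<open>ext\<close>: before
  injectivity is known, it is not clear that the extension has a value at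
  \<open>g v\<close>.\<close>

locale involutive_subst =
  fixes g :: "coord \<Rightarrow> ratfun"
  assumes inv: "rconst.peval.val g (g v) (rvar v)"
begin

lemma val_peval: "rconst.peval.val g (peval rconst g f) (Fract f 1)"
proof (induction f rule: cpoly_induct)
  case (const c)
  then show ?case
    using rconst.val_rconst[of g c] unfolding rconst.peval_const by (metis rconst_def)
next
  case (var v)
  show ?case using inv[of v] by (simp only: rconst.peval_var rvar_def)
next
  case (add f h)
  then show ?case
    using rconst.peval.val_add[OF add] by (simp add: rconst.peval_add)
next
  case (mult f h)
  then show ?case
    using rconst.peval.val_mult[OF mult] by (simp add: rconst.peval_mult)
qed

text \<open>If the image of \<open>f\<close> is 0, then 0 has the value \<open>Fract f 1\<close>
  under the substitution, and values are unique.\<close>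

lemma peval_eq_0: "peval rconst g f = 0 \<longleftrightarrow> f = 0"
proof
  assume "peval rconst g f = 0"
  then have "Fract f 1 = 0"
    using val_peval[of f] rconst.peval.val_unique rconst.peval.val_0 by metis
  then show "f = 0" by (simp add: Zero_fract_def eq_fract)
qed (simp add: rconst.peval_zero)

lemma val_ext: "rconst.peval.val g f (ext g f)"
proof -
  obtain n d where "f = Fract n d" "d \<noteq> 0" by (cases f)
  then have "rconst.peval.val g f (peval rconst g n / peval rconst g d)"
    unfolding rconst.peval.val_def using peval_eq_0 by blast
  then show ?thesis using ext_eqI by metis
qed

lemma ext_add: "ext g (f + h) = ext g f + ext g h"
  by (intro ext_eqI rconst.peval.val_add val_ext)

lemma ext_mult: "ext g (f * h) = ext g f * ext g h"
  by (intro ext_eqI rconst.peval.val_mult val_ext)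

lemma ext_rconst: "ext g (rconst c) = rconst c"
  by (intro ext_eqI rconst.val_rconst)

lemma ext_rvar: "ext g (rvar v) = g v"
  by (intro ext_eqI rconst.val_rvar)

end

section \<open>Field homomorphisms over the constants\<close>

locale field_hom =
  fixes s :: "ratfun \<Rightarrow> ratfun"
  assumes add: "s (f + g) = s f + s g"
    and mult: "s (f * g) = s f * s g"
    and const: "s (rconst c) = rconst c"
begin

lemma zero: "s 0 = 0"
  using const[of 0] by (simp add: rconst.const_zero)

lemma one: "s 1 = 1"
  using const[of 1] by (simp add: rconst.const_one)

lemma minus: "s (- f) = - s f"
  using add[of f "- f"] zero by (simp add: eq_neg_iff_add_eq_0 add.commute)

lemma diff: "s (f - g) = s f - s g"
  using add[of f "- g"] minus[of g] by simp

lemma numeral: "s (numeral n) = numeral n"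
proof -
  have "s (of_nat k) = of_nat k" for k
    by (induction k) (simp_all add: zero add one)
  from this[of "numeral n"] show ?thesis by simp
qed

text \<open>A nonzero element has an inverse, whose image would have to invert 0. This is the source
  of most later facts that a denominator does not vanish.\<close>

lemma eq_0_iff: "s f = 0 \<longleftrightarrow> f = 0"
proof
  assume "s f = 0"
  then have "s (f * inverse f) = 0" by (simp add: mult)
  then show "f = 0" using one by (cases "f = 0") auto
qed (simp add: zero)

lemma divide: "s (f / g) = s f / s g"
proof (cases "g = 0")
  case False
  then have "s (f / g) * s g = s f" by (simp flip: mult)
  then show ?thesis using False eq_0_iff by (metis nonzero_eq_divide_eq)
qed (simp add: zero)

lemma sum: "s (\<Sum>i\<in>A. f i) = (\<Sum>i\<in>A. s (f i))"
  by (induction A rule: infinite_finite_induct) (simp_all add: zero add)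

lemma prod: "s (\<Prod>i\<in>A. f i) = (\<Prod>i\<in>A. s (f i))"
  by (induction A rule: infinite_finite_induct) (simp_all add: one mult)

lemma power: "s (f ^ n) = s f ^ n"
  by (induction n) (simp_all add: one mult)

lemma Fract: "s (Fract f 1) = peval rconst (\<lambda>v. s (rvar v)) f"
  by (simp add: Fract_conv_peval peval_def sum prod power mult const)

lemmas simps = add mult const zero one minus diff numeral divide power

end

lemma field_hom_comp: "field_hom s \<Longrightarrow> field_hom s' \<Longrightarrow> field_hom (s \<circ> s')"
  by (simp add: field_hom_def)

lemma field_hom_id: "field_hom id"
  by (simp add: field_hom_def)

lemma field_hom_eqI:
  assumes "field_hom s" "field_hom s'" and eq: "\<And>v. s (rvar v) = s' (rvar v)"
  shows "s = s'"
proof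
  interpret s: field_hom s by fact
  interpret s': field_hom s' by fact
  fix f :: ratfun
  obtain n d where nd: "f = Fract n d" "d \<noteq> 0" by (cases f)
  then have "f = Fract n 1 / Fract d 1" by simp
  then show "s f = s' f"
    by (simp only: s.divide s'.divide s.Fract s'.Fract eq)
qed

lemma field_automorphism_involution:
  assumes "field_hom s" "s \<circ> s = id"
  shows "field_automorphism s"
  using assms o_bij[of s s] unfolding field_hom_def field_automorphism_def by simp

context involutive_subst
begin

lemma field_hom_ext: "field_hom (ext g)"
  by unfold_locales (fact ext_add ext_mult ext_rconst)+

lemma ext_ext: "ext g \<circ> ext g = id"
  using field_hom_ext inv
  by (intro field_hom_eqI field_hom_comp field_hom_id) (simp_all add: ext_rvar ext_eqI)

end

lemma rvar_eq_iff: "rvar v = rvar v' \<longleftrightarrow> v = v'"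
proof -
  have *: "Poly_Mapping.single a (1::'b::zero_neq_one) = Poly_Mapping.single b 1 \<longleftrightarrow> a = b" for a b :: 'a
    by (metis keys_single one_neq_zero singleton_inject)
  show ?thesis
    unfolding rvar_def by (simp add: eq_fract * del: One_nat_def)
qed

lemma rvar_neq_const: "rvar v \<noteq> rconst c"
proof
  assume "rvar v = rconst c"
  then have "Poly_Mapping.single (Poly_Mapping.single v 1) 1 = (Poly_Mapping.single 0 c :: cpoly)"
    unfolding rvar_def rconst_def by (simp add: eq_fract del: One_nat_def)
  from arg_cong[OF this, of "\<lambda>f. Poly_Mapping.lookup f (Poly_Mapping.single v 1)"]
  show False
    by (simp add: lookup_single when_def split: if_splits)
      (metis keys_single keys_zero insert_not_empty nat.distinct(1))
qed

lemma rvar_neq_0: "rvar v \<noteq> 0" and rvar_neq_1: "rvar v \<noteq> 1"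
  using rvar_neq_const[of v 0] rvar_neq_const[of v 1]
  by (simp_all add: rconst.const_zero rconst.const_one)

subsection \<open>The field of parameters\<close>

lemma par_poly_add: "par_poly f \<Longrightarrow> par_poly g \<Longrightarrow> par_poly (f + g)"
  using keys_add[of f g] by (auto simp: par_poly_def)

lemma par_poly_minus: "par_poly f \<Longrightarrow> par_poly (- f)"
  by (simp add: par_poly_def in_keys_iff)

lemma par_poly_mult: "par_poly f \<Longrightarrow> par_poly g \<Longrightarrow> par_poly (f * g)"
  unfolding par_poly_def
proof
  fix m
  assume *: "\<forall>m\<in>Poly_Mapping.keys f. Poly_Mapping.keys m \<subseteq> {CA0, CA1, CA2, CA3, CA4, CA5}"
    "\<forall>m\<in>Poly_Mapping.keys g. Poly_Mapping.keys m \<subseteq> {CA0, CA1, CA2, CA3, CA4, CA5}"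
    "m \<in> Poly_Mapping.keys (f * g)"
  then obtain a b where "m = a + b" "a \<in> Poly_Mapping.keys f" "b \<in> Poly_Mapping.keys g"
    using keys_mult[of f g] by blast
  then show "Poly_Mapping.keys m \<subseteq> {CA0, CA1, CA2, CA3, CA4, CA5}"
    using * keys_add[of a b] by blast
qed

lemma par_field_add: "f \<in> par_field \<Longrightarrow> g \<in> par_field \<Longrightarrow> f + g \<in> par_field"
  unfolding par_field_def
  by clarsimp (intro exI conjI, rule refl, auto intro: par_poly_add par_poly_mult)

lemma par_field_mult: "f \<in> par_field \<Longrightarrow> g \<in> par_field \<Longrightarrow> f * g \<in> par_field"
  unfolding par_field_def
  by clarsimp (intro exI conjI, rule refl, auto intro: par_poly_add par_poly_mult)

lemma par_field_poly: "par_poly f \<Longrightarrow> Fract f 1 \<in> par_field"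
  unfolding par_field_def
  by (clarsimp, intro exI conjI, rule refl) (auto simp: par_poly_def)

lemma par_field_minus: "f \<in> par_field \<Longrightarrow> - f \<in> par_field"
  unfolding par_field_def
  by clarsimp (intro exI conjI, rule refl, auto intro: par_poly_minus)

lemma par_field_rconst: "rconst c \<in> par_field"
  unfolding rconst_def by (rule par_field_poly) (simp add: par_poly_def)

lemma par_field_0: "0 \<in> par_field" and par_field_1: "1 \<in> par_field"
  using par_field_rconst[of 0] par_field_rconst[of 1]
  by (simp_all add: rconst.const_zero rconst.const_one)

lemma par_field_inverse:
  assumes "f \<in> par_field"
  shows "inverse f \<in> par_field"
proof -
  obtain n d where *: "f = Fract n d" "d \<noteq> 0" "par_poly n" "par_poly d"
    using assms by (auto simp: par_field_def)
  show ?thesis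
  proof (cases "n = 0")
    case True
    then show ?thesis using * par_field_0 by (simp add: fract_collapse)
  next
    case False
    then show ?thesis using * by (auto simp: par_field_def)
  qed
qed

lemma par_field_diff: "f \<in> par_field \<Longrightarrow> g \<in> par_field \<Longrightarrow> f - g \<in> par_field"
  using par_field_add[of f "- g"] par_field_minus[of g] by simp

lemma par_field_divide: "f \<in> par_field \<Longrightarrow> g \<in> par_field \<Longrightarrow> f / g \<in> par_field"
  unfolding divide_inverse by (intro par_field_mult par_field_inverse)

lemma par_field_numeral: "numeral n \<in> par_field"
proof -
  have "of_nat k \<in> par_field" for k
    by (induction k) (simp_all add: par_field_0 par_field_add par_field_1)
  from this[of "numeral n"] show ?thesis by simp
qed

lemma par_field_rvar: "v \<in> {CA0, CA1, CA2, CA3, CA4, CA5} \<Longrightarrow> rvar v \<in> par_field"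
  unfolding rvar_def by (rule par_field_poly) (auto simp: par_poly_def)

lemma par_field_par: "par i \<in> par_field"
  unfolding par_def by (simp add: par_field_rvar par_field_rconst par_field_diff par_field_add)

lemma par_field_sum: "(\<And>i. i \<in> A \<Longrightarrow> f i \<in> par_field) \<Longrightarrow> (\<Sum>i\<in>A. f i) \<in> par_field"
  by (induction A rule: infinite_finite_induct) (simp_all add: par_field_0 par_field_add)

lemma par_field_prod: "(\<And>i. i \<in> A \<Longrightarrow> f i \<in> par_field) \<Longrightarrow> (\<Prod>i\<in>A. f i) \<in> par_field"
  by (induction A rule: infinite_finite_induct) (simp_all add: par_field_1 par_field_mult)

lemma par_field_power: "f \<in> par_field \<Longrightarrow> f ^ n \<in> par_field"
  by (induction n) (simp_all add: par_field_1 par_field_mult)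

lemmas par_field_intros = par_field_add par_field_mult par_field_minus par_field_diff
  par_field_numeral par_field_par

text \<open>The elements \<open>par 0\<close> to \<open>par 5\<close> are the variables that
  generate the field, so their images decide one inclusion; the other follows because
  \<open>s\<close> is its own inverse.\<close>

lemma par_field_image:
  assumes "field_hom s" "s \<circ> s = id"
    and par: "\<And>i. i \<le> 5 \<Longrightarrow> s (par i) \<in> par_field"
  shows "s ` par_field = par_field"
proof -
  interpret field_hom s by fact
  have var: "s (rvar v) \<in> par_field" if "v \<in> {CA0, CA1, CA2, CA3, CA4, CA5}" for v
    using that par[of 0] par[of 1] par[of 2] par[of 3] par[of 4] par[of 5]
    by (auto simp: par_def)
  have poly: "s (Fract f 1) \<in> par_field" if "par_poly f" for f
    unfolding Fract peval_def
    using that unfolding par_poly_def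
    by (intro par_field_sum par_field_mult par_field_prod par_field_power par_field_rconst var) auto
  have sub: "s f \<in> par_field" if "f \<in> par_field" for f
  proof -
    obtain n d where nd: "f = Fract n d" "par_poly n" "par_poly d"
      using \<open>f \<in> par_field\<close> by (auto simp: par_field_def)
    then have "f = Fract n 1 / Fract d 1" by simp
    then show ?thesis
      using nd by (simp only: divide par_field_divide poly)
  qed
  moreover have "f \<in> s ` par_field" if "f \<in> par_field" for f
    using sub[OF that] assms(2) by (metis comp_apply id_apply image_eqI)
  ultimately show ?thesis by blast
qed

subsection \<open>The transformations and their relations\<close>

lemma par_simps:
  "par 0 = rvar CA0" "par (Suc 0) = rvar CA1" "par 1 = rvar CA1" "par 2 = rvar CA2" "par 3 = rvar CA3"
  "par 4 = rvar CA4" "par 5 = rvar CA5"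
  "par 6 = rconst (1/2) - (rvar CA0 + rvar CA1 + rvar CA2 + rvar CA3 + rvar CA4 + rvar CA5)"
  by (simp_all add: par_def)

text \<open>Only the eleven independent variables are listed; the image of \<open>\<alpha> 6\<close>
  follows from its definition by the other six parameters.\<close>

fun g0 :: "coord \<Rightarrow> ratfun" where
  "g0 CX = (\<^bold>t * \<^bold>x - 1) / (\<^bold>t - 1)" | "g0 CY = (\<^bold>t - 1) * \<^bold>y / \<^bold>t"
| "g0 CZ = (\<^bold>t * \<^bold>z - 1) / (\<^bold>t - 1)" | "g0 CW = (\<^bold>t - 1) * \<^bold>w / \<^bold>t" | "g0 CT = 1 - \<^bold>t"
| "g0 CA0 = - \<^bold>\<alpha> 0" | "g0 CA1 = \<^bold>\<alpha> 1 + 2 * \<^bold>\<alpha> 0" | "g0 CA2 = \<^bold>\<alpha> 2" | "g0 CA3 = \<^bold>\<alpha> 3"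
| "g0 CA4 = \<^bold>\<alpha> 4" | "g0 CA5 = \<^bold>\<alpha> 5"

fun g1 :: "coord \<Rightarrow> ratfun" where
  "g1 CX = \<^bold>x" | "g1 CY = \<^bold>y - \<^bold>\<alpha> 1 / \<^bold>x"
| "g1 CZ = \<^bold>z" | "g1 CW = \<^bold>w" | "g1 CT = \<^bold>t"
| "g1 CA0 = \<^bold>\<alpha> 0 + \<^bold>\<alpha> 1" | "g1 CA1 = - \<^bold>\<alpha> 1" | "g1 CA2 = \<^bold>\<alpha> 2 + \<^bold>\<alpha> 1" | "g1 CA3 = \<^bold>\<alpha> 3"
| "g1 CA4 = \<^bold>\<alpha> 4" | "g1 CA5 = \<^bold>\<alpha> 5"

fun g2 :: "coord \<Rightarrow> ratfun" where
  "g2 CX = \<^bold>x + \<^bold>\<alpha> 2 / \<^bold>y" | "g2 CY = \<^bold>y"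
| "g2 CZ = \<^bold>z" | "g2 CW = \<^bold>w" | "g2 CT = \<^bold>t"
| "g2 CA0 = \<^bold>\<alpha> 0" | "g2 CA1 = \<^bold>\<alpha> 1 + \<^bold>\<alpha> 2" | "g2 CA2 = - \<^bold>\<alpha> 2" | "g2 CA3 = \<^bold>\<alpha> 3 + \<^bold>\<alpha> 2"
| "g2 CA4 = \<^bold>\<alpha> 4" | "g2 CA5 = \<^bold>\<alpha> 5"

fun g3 :: "coord \<Rightarrow> ratfun" where
  "g3 CX = \<^bold>x" | "g3 CY = \<^bold>y - \<^bold>\<alpha> 3 / (\<^bold>x - \<^bold>z)"
| "g3 CZ = \<^bold>z" | "g3 CW = \<^bold>w + \<^bold>\<alpha> 3 / (\<^bold>x - \<^bold>z)" | "g3 CT = \<^bold>t"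
| "g3 CA0 = \<^bold>\<alpha> 0" | "g3 CA1 = \<^bold>\<alpha> 1" | "g3 CA2 = \<^bold>\<alpha> 2 + \<^bold>\<alpha> 3" | "g3 CA3 = - \<^bold>\<alpha> 3"
| "g3 CA4 = \<^bold>\<alpha> 4 + \<^bold>\<alpha> 3" | "g3 CA5 = \<^bold>\<alpha> 5"

fun g\<phi> :: "coord \<Rightarrow> ratfun" where
  "g\<phi> CX = 1 / (\<^bold>t * \<^bold>z)" | "g\<phi> CY = - \<^bold>t * \<^bold>z * (\<^bold>z * \<^bold>w + \<^bold>\<alpha> 4)"
| "g\<phi> CZ = 1 / (\<^bold>t * \<^bold>x)" | "g\<phi> CW = - \<^bold>t * \<^bold>x * (\<^bold>x * \<^bold>y + \<^bold>\<alpha> 2)" | "g\<phi> CT = \<^bold>t"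
| "g\<phi> CA0 = \<^bold>\<alpha> 6" | "g\<phi> CA1 = \<^bold>\<alpha> 5" | "g\<phi> CA2 = \<^bold>\<alpha> 4" | "g\<phi> CA3 = \<^bold>\<alpha> 3"
| "g\<phi> CA4 = \<^bold>\<alpha> 2" | "g\<phi> CA5 = \<^bold>\<alpha> 1"

lemma nonzero:
  "\<^bold>x \<noteq> 0" "\<^bold>y \<noteq> 0" "\<^bold>z \<noteq> 0" "\<^bold>w \<noteq> 0" "\<^bold>t \<noteq> 0" "\<^bold>x - 1 \<noteq> 0" "\<^bold>z - 1 \<noteq> 0" "\<^bold>t - 1 \<noteq> 0" "\<^bold>x - \<^bold>z \<noteq> 0"
  using rvar_neq_0 rvar_neq_1 rvar_eq_iff by simp_all

text \<open>The existential leaves the value schematic: the rules for \<open>val\<close> compute it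
  from the shape of \<open>g v\<close>, and only afterwards is it compared with the variable. What
  remains are nonvanishing denominators and an identity of rational functions.\<close>

lemma involutive_substI:
  assumes "\<And>v. \<exists>c. rconst.peval.val g (g v) c \<and> c = rvar v"
  shows "involutive_subst g"
  using assms by unfold_locales blast

lemmas val_rules = rconst.peval.val_intros rconst.val_rvar rconst.val_rconst

interpretation g0: involutive_subst g0
proof (rule involutive_substI)
  fix v
  show "\<exists>c. rconst.peval.val g0 (g0 v) c \<and> c = rvar v"
    by (cases v; simp only: g0.simps par_simps; rule exI, rule conjI, (rule val_rules)+)
      (use nonzero in \<open>simp_all add: par_simps divide_simps\<close>, (simp_all add: algebra_simps)?)
qed

interpretation g1: involutive_subst g1
proof (rule involutive_substI)
  fix v
  show "\<exists>c. rconst.peval.val g1 (g1 v) c \<and> c = rvar v"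
    by (cases v; simp only: g1.simps par_simps; rule exI, rule conjI, (rule val_rules)+)
      (use nonzero in \<open>simp_all add: par_simps divide_simps\<close>, (simp_all add: algebra_simps)?)
qed

interpretation g2: involutive_subst g2
proof (rule involutive_substI)
  fix v
  show "\<exists>c. rconst.peval.val g2 (g2 v) c \<and> c = rvar v"
    by (cases v; simp only: g2.simps par_simps; rule exI, rule conjI, (rule val_rules)+)
      (use nonzero in \<open>simp_all add: par_simps divide_simps\<close>, (simp_all add: algebra_simps)?)
qed

interpretation g3: involutive_subst g3
proof (rule involutive_substI)
  fix v
  show "\<exists>c. rconst.peval.val g3 (g3 v) c \<and> c = rvar v"
    by (cases v; simp only: g3.simps par_simps; rule exI, rule conjI, (rule val_rules)+)
      (use nonzero in \<open>simp_all add: par_simps divide_simps\<close>, (simp_all add: algebra_simps)?)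
qed

interpretation g\<phi>: involutive_subst g\<phi>
proof (rule involutive_substI)
  fix v
  show "\<exists>c. rconst.peval.val g\<phi> (g\<phi> v) c \<and> c = rvar v"
    by (cases v; simp only: g\<phi>.simps par_simps; rule exI, rule conjI, (rule val_rules)+)
      (use nonzero in \<open>simp_all add: par_simps divide_simps\<close>, (simp_all add: algebra_simps)?)
qed

text \<open>\<open>g4\<close>, \<open>g5\<close> and \<open>g6\<close> are the closed forms of the
  conjugates of \<open>g2\<close>, \<open>g1\<close> and \<open>g0\<close> by \<open>\<phi>\<close>;
  they serve to identify \<open>u 4\<close>, \<open>u 5\<close> and \<open>u 6\<close> with the
  prescribed formulas.\<close>

fun g4 :: "coord \<Rightarrow> ratfun" where
  "g4 CX = \<^bold>x" | "g4 CY = \<^bold>y"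
| "g4 CZ = \<^bold>z + \<^bold>\<alpha> 4 / \<^bold>w" | "g4 CW = \<^bold>w" | "g4 CT = \<^bold>t"
| "g4 CA0 = \<^bold>\<alpha> 0" | "g4 CA1 = \<^bold>\<alpha> 1" | "g4 CA2 = \<^bold>\<alpha> 2" | "g4 CA3 = \<^bold>\<alpha> 3 + \<^bold>\<alpha> 4"
| "g4 CA4 = - \<^bold>\<alpha> 4" | "g4 CA5 = \<^bold>\<alpha> 5 + \<^bold>\<alpha> 4"

fun g5 :: "coord \<Rightarrow> ratfun" where
  "g5 CX = \<^bold>x" | "g5 CY = \<^bold>y"
| "g5 CZ = \<^bold>z" | "g5 CW = \<^bold>w" | "g5 CT = \<^bold>t"
| "g5 CA0 = \<^bold>\<alpha> 0" | "g5 CA1 = \<^bold>\<alpha> 1" | "g5 CA2 = \<^bold>\<alpha> 2" | "g5 CA3 = \<^bold>\<alpha> 3"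
| "g5 CA4 = \<^bold>\<alpha> 4 + \<^bold>\<alpha> 5" | "g5 CA5 = - \<^bold>\<alpha> 5"

fun g6 :: "coord \<Rightarrow> ratfun" where
  "g6 CX = \<^bold>x / (\<^bold>x - 1)" | "g6 CY = - (\<^bold>x - 1) * ((\<^bold>x - 1) * \<^bold>y + \<^bold>\<alpha> 2)"
| "g6 CZ = \<^bold>z / (\<^bold>z - 1)" | "g6 CW = - (\<^bold>z - 1) * ((\<^bold>z - 1) * \<^bold>w + \<^bold>\<alpha> 4)" | "g6 CT = 1 - \<^bold>t"
| "g6 CA0 = \<^bold>\<alpha> 0" | "g6 CA1 = \<^bold>\<alpha> 1" | "g6 CA2 = \<^bold>\<alpha> 2" | "g6 CA3 = \<^bold>\<alpha> 3"
| "g6 CA4 = \<^bold>\<alpha> 4" | "g6 CA5 = \<^bold>\<alpha> 5 + 2 * \<^bold>\<alpha> 6"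

definition \<phi> :: "ratfun \<Rightarrow> ratfun"
  where "\<phi> = ext g\<phi>"

text \<open>Taking the last three as conjugates makes them homomorphisms and involutions at once.
  The value \<open>id\<close> beyond index 6 keeps both properties true for every index.\<close>

definition u :: "nat \<Rightarrow> ratfun \<Rightarrow> ratfun"
  where "u i =
    (if i = 0 then ext g0 else if i = 1 then ext g1 else if i = 2 then ext g2
     else if i = 3 then ext g3 else if i = 4 then \<phi> \<circ> ext g2 \<circ> \<phi>
     else if i = 5 then \<phi> \<circ> ext g1 \<circ> \<phi> else if i = 6 then \<phi> \<circ> ext g0 \<circ> \<phi> else id)"

interpretation \<phi>: field_hom \<phi>
  unfolding \<phi>_def by (rule g\<phi>.field_hom_ext)

interpretation u: field_hom "u i" for i
  unfolding u_def \<phi>_def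
  by (auto intro!: g0.field_hom_ext g1.field_hom_ext g2.field_hom_ext g3.field_hom_ext
      g\<phi>.field_hom_ext field_hom_comp field_hom_id)

lemma \<phi>_rvar: "\<phi> (rvar v) = g\<phi> v"
  by (simp add: \<phi>_def g\<phi>.ext_rvar)

text \<open>These are factors of the images of \<open>rvar CW\<close> and \<open>rvar CY\<close>'s
  counterparts under \<open>\<phi>\<close>: \<open>\<phi>\<close> sends \<open>rvar CY\<close> to a
  multiple of the first and \<open>rvar CW\<close> to a multiple of the second, and neither image is
  0.\<close>

lemma nonzero_\<phi>: "\<^bold>z * \<^bold>w + rvar CA4 \<noteq> 0" "\<^bold>x * \<^bold>y + rvar CA2 \<noteq> 0"
proof -
  have "\<phi> \<^bold>y \<noteq> 0" "\<phi> \<^bold>w \<noteq> 0"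
    using nonzero by (simp_all add: \<phi>.eq_0_iff)
  then show "\<^bold>z * \<^bold>w + rvar CA4 \<noteq> 0" "\<^bold>x * \<^bold>y + rvar CA2 \<noteq> 0"
    by (auto simp: \<phi>_rvar par_simps)
qed

lemma \<phi>_\<phi>: "\<phi> \<circ> \<phi> = id"
  unfolding \<phi>_def by (rule g\<phi>.ext_ext)

lemma comp_cancel: "s \<circ> s = id \<Longrightarrow> s \<circ> (s \<circ> r) = r"
  by (metis comp_assoc id_comp)

lemma u_u: "u i \<circ> u i = id"
  by (simp add: u_def g0.ext_ext g1.ext_ext g2.ext_ext g3.ext_ext comp_assoc \<phi>_\<phi> comp_cancel)

text \<open>For every index except 3 this is built into the definition of \<open>u\<close>. The node
  3 is fixed by the diagram automorphism, and that \<open>u 3\<close> commutes with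
  \<open>\<phi>\<close> is a genuine computation on the variables.\<close>

lemma \<phi>_u: "i \<le> 6 \<Longrightarrow> \<phi> \<circ> u i \<circ> \<phi> = u (6 - i)"
proof -
  assume "i \<le> 6"
  then consider "i = 0" | "i = 1" | "i = 2" | "i = 4" | "i = 5" | "i = 6" | "i = 3" by linarith
  then show ?thesis
  proof cases
    case 7
    have "\<phi> \<circ> ext g3 \<circ> \<phi> = ext g3"
    proof (intro field_hom_eqI field_hom_comp \<phi>.field_hom_axioms g3.field_hom_ext)
      interpret s: field_hom "ext g3" by (rule g3.field_hom_ext)
      fix v
      have "\<phi> (ext g3 (\<phi> (rvar v))) = ext g3 (rvar v)"
        using nonzero nonzero_\<phi>
        by (cases v; simp add: \<phi>.simps s.simps \<phi>_rvar g3.ext_rvar par_simps divide_simps;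
            (simp add: algebra_simps; fail)?)
      then show "(\<phi> \<circ> ext g3 \<circ> \<phi>) (rvar v) = ext g3 (rvar v)" by simp
    qed
    then show ?thesis using 7 by (simp add: u_def)
  qed (simp_all add: u_def comp_assoc \<phi>_\<phi> comp_cancel)
qed

lemma u_4: "u 4 (rvar v) = g4 v"
proof -
  interpret s: field_hom "ext g2" by (rule g2.field_hom_ext)
  show ?thesis
    unfolding u_def using nonzero nonzero_\<phi>
    by (cases v; simp add: \<phi>.simps s.simps \<phi>_rvar g2.ext_rvar par_simps divide_simps;
        (simp add: algebra_simps; fail)?)
qed

lemma u_5: "u 5 (rvar v) = g5 v"
proof -
  interpret s: field_hom "ext g1" by (rule g1.field_hom_ext)
  show ?thesis
    unfolding u_def using nonzero nonzero_\<phi>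
    by (cases v; simp add: \<phi>.simps s.simps \<phi>_rvar g1.ext_rvar par_simps divide_simps;
        (simp add: algebra_simps; fail)?)
qed

lemma u_6: "u 6 (rvar v) = g6 v"
proof -
  interpret s: field_hom "ext g0" by (rule g0.field_hom_ext)
  show ?thesis
    unfolding u_def using nonzero nonzero_\<phi>
    by (cases v; simp add: \<phi>.simps s.simps \<phi>_rvar g0.ext_rvar par_simps divide_simps;
        (simp add: algebra_simps; fail)?)
qed
lemma u_rvar: "u 0 (rvar v) = g0 v" "u 1 (rvar v) = g1 v" "u (Suc 0) (rvar v) = g1 v"
  "u 2 (rvar v) = g2 v" "u 3 (rvar v) = g3 v"
  by (simp_all add: u_def g0.ext_rvar g1.ext_rvar g2.ext_rvar g3.ext_rvar)

lemmas u_eval = u.simps u_rvar u_4 u_5 u_6 par_simps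

section \<open>Braid relations and commutations\<close>

lemma braid_01: "u 0 \<circ> u 1 \<circ> u 0 \<circ> u 1 = u 1 \<circ> u 0 \<circ> u 1 \<circ> u 0"
proof (intro field_hom_eqI field_hom_comp u.field_hom_axioms)
  fix v
  \<comment> \<open>\<open>u 1\<close> divides by \<open>x\<close>, so the composites divide by its
    image under \<open>u 0\<close>, whose numerator is \<open>t x - 1\<close>.\<close>
  have "u 0 \<^bold>x \<noteq> 0" using nonzero by (simp add: u.eq_0_iff)
  then have "\<^bold>t * \<^bold>x - 1 \<noteq> 0" by (auto simp: u_rvar)
  then show "(u 0 \<circ> u 1 \<circ> u 0 \<circ> u 1) (rvar v) = (u 1 \<circ> u 0 \<circ> u 1 \<circ> u 0) (rvar v)"
    using nonzero
    by (cases v; simp add: u_eval divide_simps; (simp add: algebra_simps; fail)?)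
qed

lemma braid_12: "u 1 \<circ> u 2 \<circ> u 1 = u 2 \<circ> u 1 \<circ> u 2"
proof (intro field_hom_eqI field_hom_comp u.field_hom_axioms)
  fix v
  \<comment> \<open>The denominators of both composites are images of \<open>x\<close> and
    \<open>y\<close> under words in \<open>u 1\<close> and \<open>u 2\<close>.\<close>
  have "u 1 \<^bold>y \<noteq> 0" "u 2 \<^bold>x \<noteq> 0" "u 1 (u 2 \<^bold>x) \<noteq> 0" "u 2 (u 1 \<^bold>y) \<noteq> 0"
    using nonzero by (simp_all add: u.eq_0_iff)
  \<comment> \<open>The last two expressions equal the first two in reverse order: they are
    \<open>x y - \<alpha> 1\<close> and \<open>x y + \<alpha> 2\<close> in the uncancelled shape
    produced by clearing denominators.\<close>
  then have "\<^bold>x * \<^bold>y - rvar CA1 \<noteq> 0" "\<^bold>x * \<^bold>y + rvar CA2 \<noteq> 0"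
      "\<^bold>x * \<^bold>y + rvar CA2 - (rvar CA1 + rvar CA2) \<noteq> 0"
      "\<^bold>x * \<^bold>y - rvar CA1 + (rvar CA1 + rvar CA2) \<noteq> 0"
    using nonzero by (auto simp: u_eval divide_simps split: if_splits)
  then show "(u 1 \<circ> u 2 \<circ> u 1) (rvar v) = (u 2 \<circ> u 1 \<circ> u 2) (rvar v)"
    using nonzero
    by (cases v; simp add: u_eval divide_simps; (simp add: algebra_simps; fail)?)
qed

lemma braid_23: "u 2 \<circ> u 3 \<circ> u 2 = u 3 \<circ> u 2 \<circ> u 3"
proof (intro field_hom_eqI field_hom_comp u.field_hom_axioms)
  fix v
  have "u 3 \<^bold>y \<noteq> 0" "u 2 (\<^bold>x - \<^bold>z) \<noteq> 0" "u 3 (u 2 (\<^bold>x - \<^bold>z)) \<noteq> 0" "u 2 (u 3 \<^bold>y) \<noteq> 0"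
    using nonzero by (simp_all add: u.eq_0_iff del: right_minus_eq)
  then have "(\<^bold>x - \<^bold>z) * \<^bold>y - rvar CA3 \<noteq> 0" "(\<^bold>x - \<^bold>z) * \<^bold>y + rvar CA2 \<noteq> 0"
      "(\<^bold>x - \<^bold>z) * \<^bold>y - rvar CA3 + (rvar CA2 + rvar CA3) \<noteq> 0"
      "(\<^bold>x - \<^bold>z) * \<^bold>y + rvar CA2 - (rvar CA3 + rvar CA2) \<noteq> 0"
    using nonzero by (auto simp: u_eval field_simps split: if_splits)
  then have "\<^bold>x * \<^bold>y + rvar CA2 - \<^bold>z * \<^bold>y \<noteq> 0" "\<^bold>y * (\<^bold>x - \<^bold>z) - rvar CA3 \<noteq> 0"
    using nonzero by (simp_all add: algebra_simps)
  \<comment> \<open>One denominator appears in expanded form; it is the product of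
    \<open>x - z\<close> and \<open>(x - z) y + \<alpha> 2\<close>, both already known to be
    nonzero.\<close>
  moreover from this(1) have "(\<^bold>x - \<^bold>z) * (\<^bold>x * \<^bold>y + rvar CA2 - \<^bold>z * \<^bold>y) \<noteq> 0"
    using nonzero by simp
  then have "\<^bold>x * (\<^bold>y * (\<^bold>x - \<^bold>z) - rvar CA3) + (rvar CA2 + rvar CA3) * (\<^bold>x - \<^bold>z) -
      \<^bold>z * (\<^bold>y * (\<^bold>x - \<^bold>z) - rvar CA3) \<noteq> 0"
    by (rule back_subst[of "\<lambda>a. a \<noteq> 0"]) (simp add: algebra_simps)
  ultimately show "(u 2 \<circ> u 3 \<circ> u 2) (rvar v) = (u 3 \<circ> u 2 \<circ> u 3) (rvar v)"
    using nonzero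
    by (cases v; simp add: u_eval divide_simps; (simp add: algebra_simps; fail)?)
qed

text \<open>One pair of non-adjacent nodes from each orbit of the flip of the diagram: the pairs
  (0,6), (1,5), (2,4) are fixed, the other six stand for two pairs each, which makes up all
  fifteen.\<close>

lemma commute:
  "u 0 \<circ> u 2 = u 2 \<circ> u 0" "u 0 \<circ> u 3 = u 3 \<circ> u 0" "u 0 \<circ> u 4 = u 4 \<circ> u 0"
  "u 0 \<circ> u 5 = u 5 \<circ> u 0" "u 0 \<circ> u 6 = u 6 \<circ> u 0" "u 1 \<circ> u 3 = u 3 \<circ> u 1"
  "u 1 \<circ> u 4 = u 4 \<circ> u 1" "u 1 \<circ> u 5 = u 5 \<circ> u 1" "u 2 \<circ> u 4 = u 4 \<circ> u 2"
proof -
  \<comment> \<open>\<open>u 0\<close> moves the denominators \<open>x - 1\<close> and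
    \<open>z - 1\<close> of \<open>u 6\<close> and \<open>x - z\<close> of
    \<open>u 3\<close>.\<close>
  have "u 0 (\<^bold>x - 1) \<noteq> 0" "u 0 (\<^bold>z - 1) \<noteq> 0" "u 0 (\<^bold>x - \<^bold>z) \<noteq> 0"
    using nonzero by (simp_all add: u.eq_0_iff del: right_minus_eq)
  then have "\<^bold>t * \<^bold>x - 1 - (\<^bold>t - 1) \<noteq> 0" "\<^bold>t * \<^bold>z - 1 - (\<^bold>t - 1) \<noteq> 0" "\<^bold>t * \<^bold>x - \<^bold>t * \<^bold>z \<noteq> 0"
    using nonzero by (auto simp: u_eval field_simps split: if_splits)
  note nz = this nonzero
  have comm: "u i \<circ> u j = u j \<circ> u i" if "\<And>v. u i (u j (rvar v)) = u j (u i (rvar v))" for i j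
    using that by (intro field_hom_eqI field_hom_comp u.field_hom_axioms) simp
  show "u 0 \<circ> u 2 = u 2 \<circ> u 0" "u 0 \<circ> u 3 = u 3 \<circ> u 0" "u 0 \<circ> u 4 = u 4 \<circ> u 0"
    "u 0 \<circ> u 5 = u 5 \<circ> u 0" "u 0 \<circ> u 6 = u 6 \<circ> u 0" "u 1 \<circ> u 3 = u 3 \<circ> u 1"
    "u 1 \<circ> u 4 = u 4 \<circ> u 1" "u 1 \<circ> u 5 = u 5 \<circ> u 1" "u 2 \<circ> u 4 = u 4 \<circ> u 2"
    by (rule comm, rename_tac v, case_tac v; insert nz; simp add: u_eval divide_simps;
        (simp add: algebra_simps; fail)?)+
qed

section \<open>From braid relations to the orders of products\<close>

lemma atMost_6_cases: "i \<le> 6 \<longleftrightarrow> i \<in> {0, 1, 2, 3, 4, 5, 6 :: nat}"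
  by auto

text \<open>Recording both orders makes the relation symmetric, so each unordered pair has to be
  treated only once.\<close>

definition coxeter_relation :: "('a \<Rightarrow> 'a) \<Rightarrow> ('a \<Rightarrow> 'a) \<Rightarrow> nat \<Rightarrow> bool"
  where "coxeter_relation a b m \<longleftrightarrow> (a \<circ> b) ^^ m = id \<and> (b \<circ> a) ^^ m = id"

context
  fixes a b :: "'a \<Rightarrow> 'a"
  assumes a: "a \<circ> a = id" and b: "b \<circ> b = id"
begin

lemma coxeter_relation_2:
  assumes "a \<circ> b = b \<circ> a"
  shows "coxeter_relation a b 2"
proof -
  have "(a \<circ> b) ^^ 2 = (a \<circ> b) \<circ> (a \<circ> b)" "(b \<circ> a) ^^ 2 = (b \<circ> a) \<circ> (b \<circ> a)"
    by (simp_all add: numeral_2_eq_2)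
  moreover have "(a \<circ> b) \<circ> (b \<circ> a) = id" "(b \<circ> a) \<circ> (a \<circ> b) = id"
    using a b by (simp_all add: comp_assoc comp_cancel)
  ultimately show ?thesis
    using assms by (simp add: coxeter_relation_def)
qed

text \<open>The cube of \<open>a \<circ> b\<close> is the palindrome \<open>aba\<close> times the
  palindrome \<open>bab\<close>. The braid relation makes the factors equal, and a palindrome of odd
  length in involutions squares to the identity.\<close>

lemma coxeter_relation_3:
  assumes "a \<circ> b \<circ> a = b \<circ> a \<circ> b"
  shows "coxeter_relation a b 3"
proof -
  have "(a \<circ> b) ^^ 3 = (a \<circ> b \<circ> a) \<circ> (b \<circ> a \<circ> b)" "(b \<circ> a) ^^ 3 = (b \<circ> a \<circ> b) \<circ> (a \<circ> b \<circ> a)"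
    by (simp_all add: numeral_3_eq_3 comp_assoc)
  then show ?thesis
    unfolding assms using a b by (simp add: coxeter_relation_def comp_assoc comp_cancel)
qed

text \<open>For even length the two sides of the braid relation are reversals of each other, hence
  mutually inverse; the relation turns the fourth power into a word times its inverse.\<close>

lemma coxeter_relation_4:
  assumes "a \<circ> b \<circ> a \<circ> b = b \<circ> a \<circ> b \<circ> a"
  shows "coxeter_relation a b 4"
proof -
  have "(a \<circ> b) ^^ 4 = (a \<circ> b \<circ> a \<circ> b) \<circ> (a \<circ> b \<circ> a \<circ> b)"
    "(b \<circ> a) ^^ 4 = (b \<circ> a \<circ> b \<circ> a) \<circ> (b \<circ> a \<circ> b \<circ> a)"
    by (simp_all add: numeral_eq_Suc comp_assoc)
  moreover have "(a \<circ> b \<circ> a \<circ> b) \<circ> (b \<circ> a \<circ> b \<circ> a) = id" "(b \<circ> a \<circ> b \<circ> a) \<circ> (a \<circ> b \<circ> a \<circ> b) = id"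
    using a b by (simp_all add: comp_assoc comp_cancel)
  ultimately show ?thesis
    using assms by (simp add: coxeter_relation_def)
qed

end

lemma coxeter_relation_sym: "coxeter_relation a b m \<Longrightarrow> coxeter_relation b a m"
  by (simp add: coxeter_relation_def)

lemma coxeter_relation_conj:
  assumes "s \<circ> s = id" "coxeter_relation a b m"
  shows "coxeter_relation (s \<circ> a \<circ> s) (s \<circ> b \<circ> s) m"
proof -
  have conj: "((s \<circ> f \<circ> s) \<circ> (s \<circ> g \<circ> s)) ^^ m = s \<circ> (f \<circ> g) ^^ m \<circ> s" for f g
    using assms(1) by (induction m) (simp_all add: fun_eq_iff)
  show ?thesis
    using assms(2) unfolding coxeter_relation_def conj by (simp add: assms(1))
qed

lemma coxeter_relation_flip:
  assumes "i \<le> 6" "j \<le> 6" "coxeter_relation (u i) (u j) m"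
  shows "coxeter_relation (u (6 - i)) (u (6 - j)) m"
  using coxeter_relation_conj[OF \<phi>_\<phi> assms(3)] \<phi>_u assms by simp

text \<open>The adjacent pairs (0,1), (1,2), (2,3) flip to (5,6), (4,5), (3,4), so three braid
  relations and nine commutations reach all twenty-one pairs.\<close>

lemma coxeter_relations:
  assumes "i \<le> 6" "j \<le> 6" "i \<noteq> j"
  shows "coxeter_relation (u i) (u j) (coxeter_D72 i j)"
proof -
  note r4 = coxeter_relation_4[OF u_u u_u] and r3 = coxeter_relation_3[OF u_u u_u]
    and r2 = coxeter_relation_2[OF u_u u_u]
  note base = r4[OF braid_01] r3[OF braid_12] r3[OF braid_23] commute[THEN r2]
  note flip = base[THEN coxeter_relation_flip[rotated 2], simplified]
  note all = base flip
  show ?thesis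
    using assms unfolding atMost_6_cases
    by (elim insertE emptyE; simp add: coxeter_D72_def doubleton_eq_iff;
      (use all all[THEN coxeter_relation_sym] in \<open>simp; fail\<close>))
qed

subsection \<open>The Hamiltonian system\<close>

text \<open>This is \<open>t * (t - 1)\<close> times the derivative of \<open>HVI\<close> in
  \<open>P\<close>. The parameters \<open>d2\<close> and \<open>d4\<close> are absent because they
  occur only in a term free of \<open>P\<close>.\<close>

definition HVI_P :: "complex \<Rightarrow> complex \<Rightarrow> complex \<Rightarrow> complex \<Rightarrow> complex \<Rightarrow> complex \<Rightarrow> complex"
  where "HVI_P Q P t d0 d1 d3 = 2 * P * (t * Q - 1) * (Q - 1) * Q
    - ((d0 - 1) * t * (Q - 1) * Q + d1 * (Q - 1) * (t * Q - 1) + d3 * Q * (t * Q - 1))"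

text \<open>This is \<open>t * (t - 1)\<close> times the derivative of \<open>HVI\<close> in
  \<open>Q\<close>; the first bracket is the derivative of the cubic
  \<open>(t * Q - 1) * (Q - 1) * Q\<close>.\<close>

definition HVI_Q :: "complex \<Rightarrow> complex \<Rightarrow> complex \<Rightarrow> complex \<Rightarrow> complex \<Rightarrow> complex \<Rightarrow> complex
    \<Rightarrow> complex \<Rightarrow> complex"
  where "HVI_Q Q P t d0 d1 d2 d3 d4 = P^2 * (3 * t * Q^2 - 2 * (t + 1) * Q + 1)
    - ((d0 - 1) * t * (2 * Q - 1) + d1 * (2 * t * Q - t - 1) + d3 * (2 * t * Q - 1)) * P
    + d2 * (d2 + d4) * t"

text \<open>The four partial derivatives of \<open>Ham\<close> are taken without the factor
  \<open>1 / (t * (t - 1))\<close>, which makes them polynomial in \<open>t\<close> as well.\<close>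

definition Ham_y :: "(nat \<Rightarrow> complex) \<Rightarrow> complex \<Rightarrow> complex \<Rightarrow> complex \<Rightarrow> complex \<Rightarrow> complex \<Rightarrow> complex"
  where "Ham_y a x y z w t = HVI_P x y t (2 * a 0 + a 1) (a 1) (a 3 + a 5 + 2 * a 6)
    + 2 * x * (t * x - 1) * (z - 1) * w"

definition Ham_x :: "(nat \<Rightarrow> complex) \<Rightarrow> complex \<Rightarrow> complex \<Rightarrow> complex \<Rightarrow> complex \<Rightarrow> complex \<Rightarrow> complex"
  where "Ham_x a x y z w t =
    HVI_Q x y t (2 * a 0 + a 1) (a 1) (a 2) (a 3 + a 5 + 2 * a 6) (a 3 + 2 * a 4 + a 5)
    + 2 * ((2 * t * x - 1) * y + t * a 2) * (z - 1) * w"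

definition Ham_w :: "(nat \<Rightarrow> complex) \<Rightarrow> complex \<Rightarrow> complex \<Rightarrow> complex \<Rightarrow> complex \<Rightarrow> complex \<Rightarrow> complex"
  where "Ham_w a x y z w t =
    HVI_P z w t (2 * a 0 + a 1 + 2 * a 2 + a 3) (a 1 + a 3) (a 5 + 2 * a 6)
    + 2 * x * ((t * x - 1) * y + t * a 2) * (z - 1)"

definition Ham_z :: "(nat \<Rightarrow> complex) \<Rightarrow> complex \<Rightarrow> complex \<Rightarrow> complex \<Rightarrow> complex \<Rightarrow> complex \<Rightarrow> complex"
  where "Ham_z a x y z w t =
    HVI_Q z w t (2 * a 0 + a 1 + 2 * a 2 + a 3) (a 1 + a 3) (a 4) (a 5 + 2 * a 6) (a 5)
    + 2 * x * ((t * x - 1) * y + t * a 2) * w"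

lemmas Ham_defs = Ham_x_def Ham_y_def Ham_z_def Ham_w_def HVI_P_def HVI_Q_def

lemma deriv_HVI:
  "((\<lambda>v. HVI Q v t d0 d1 d2 d3 d4) has_field_derivative HVI_P Q P t d0 d1 d3 / (t * (t - 1))) (at P)"
  "((\<lambda>v. HVI v P t d0 d1 d2 d3 d4) has_field_derivative HVI_Q Q P t d0 d1 d2 d3 d4 / (t * (t - 1)))
      (at Q)"
proof -
  \<comment> \<open>With the prefactor as an opaque constant the derivative is that of a polynomial,
    and the formula also holds at \<open>t = 0\<close> and \<open>t = 1\<close>.\<close>
  define c where "c = 1 / (t * (t - 1))"
  have c: "r / (t * (t - 1)) = c * r" for r
    by (simp add: c_def)
  show "((\<lambda>v. HVI Q v t d0 d1 d2 d3 d4) has_field_derivative HVI_P Q P t d0 d1 d3 / (t * (t - 1)))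
      (at P)"
    unfolding HVI_def HVI_P_def c c_def[symmetric]
    by (rule derivative_eq_intros refl)+ (simp add: algebra_simps)
  show "((\<lambda>v. HVI v P t d0 d1 d2 d3 d4) has_field_derivative HVI_Q Q P t d0 d1 d2 d3 d4 / (t *
      (t - 1))) (at Q)"
    unfolding HVI_def HVI_Q_def c c_def[symmetric]
    by (rule derivative_eq_intros refl)+ (simp add: algebra_simps power2_eq_square)
qed

lemma deriv_Ham:
  "deriv (\<lambda>v. Ham a x v z w t) y = Ham_y a x y z w t / (t * (t - 1))"
  "deriv (\<lambda>v. Ham a v y z w t) x = Ham_x a x y z w t / (t * (t - 1))"
  "deriv (\<lambda>v. Ham a x y z v t) w = Ham_w a x y z w t / (t * (t - 1))"
  "deriv (\<lambda>v. Ham a x y v w t) z = Ham_z a x y z w t / (t * (t - 1))"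
proof -
  define c where "c = inverse (t * (t - 1))"
  note deriv = deriv_HVI[of _ t, unfolded divide_inverse c_def[symmetric]]
  note unf = divide_inverse Ham_def c_def[symmetric]
  show "deriv (\<lambda>v. Ham a x v z w t) y = Ham_y a x y z w t / (t * (t - 1))"
    unfolding unf Ham_y_def
    by (rule DERIV_imp_deriv, (rule derivative_eq_intros deriv refl)+, simp add: algebra_simps)
  show "deriv (\<lambda>v. Ham a v y z w t) x = Ham_x a x y z w t / (t * (t - 1))"
    unfolding unf Ham_x_def
    by (rule DERIV_imp_deriv, (rule derivative_eq_intros deriv refl)+, simp add: algebra_simps)
  show "deriv (\<lambda>v. Ham a x y z v t) w = Ham_w a x y z w t / (t * (t - 1))"
    unfolding unf Ham_w_def
    by (rule DERIV_imp_deriv, (rule derivative_eq_intros deriv refl)+, simp add: algebra_simps)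
  show "deriv (\<lambda>v. Ham a x y v w t) z = Ham_z a x y z w t / (t * (t - 1))"
    unfolding unf Ham_z_def
    by (rule DERIV_imp_deriv, (rule derivative_eq_intros deriv refl)+, simp add: algebra_simps)
qed

text \<open>The Hamiltonian system, with its common denominator cleared, along a curve with velocity \<open>T'\<close>.\<close>

definition flow :: "(nat \<Rightarrow> complex) \<Rightarrow> complex \<Rightarrow> complex \<Rightarrow> complex \<Rightarrow> complex \<Rightarrow> complex
    \<Rightarrow> complex \<Rightarrow> complex \<Rightarrow> complex \<Rightarrow> complex \<Rightarrow> complex \<Rightarrow> bool"
  where "flow a x y z w t x' y' z' w' T' \<longleftrightarrow>
    t * (t - 1) * x' = T' * Ham_y a x y z w t \<and> t * (t - 1) * y' = - T' * Ham_x a x y z w t \<and>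
    t * (t - 1) * z' = T' * Ham_w a x y z w t \<and> t * (t - 1) * w' = - T' * Ham_z a x y z w t"

text \<open>Clearing the denominator is an equivalence because solutions avoid the times 0 and 1.
  Naming the derivatives as numbers prepares for the chain rule.\<close>

lemma is_solution_iff: "is_solution a U X Y Z W T \<longleftrightarrow> open U \<and>
    (\<forall>s\<in>U. T s \<noteq> 0 \<and> T s \<noteq> 1 \<and>
      (\<exists>X' Y' Z' W' T'. T' \<noteq> 0 \<and> (T has_field_derivative T') (at s) \<and>
        (X has_field_derivative X') (at s) \<and> (Y has_field_derivative Y') (at s) \<and>
        (Z has_field_derivative Z') (at s) \<and> (W has_field_derivative W') (at s) \<and>
        flow a (X s) (Y s) (Z s) (W s) (T s) X' Y' Z' W' T'))"
proof -
  have *: "t * (t - 1) * c = r * h \<longleftrightarrow> c = r * (h / (t * (t - 1)))"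
    if "t \<noteq> 0" "t \<noteq> 1" for t c r h :: complex
    using that by (auto simp: field_simps)
  show ?thesis
    unfolding is_solution_def deriv_Ham flow_def
  proof (intro conj_cong refl ball_cong, goal_cases)
    case (1 s)
    show ?case unfolding mult_minus_right minus_mult_left *[OF 1(3,4)] by blast
  qed
qed

text \<open>The transformed curves agree with closed expressions only on \<open>U\<close>; since
  \<open>U\<close> is open, this suffices to transfer derivatives. Each generator is thereby reduced
  to a chain rule and an implication between two instances of \<open>flow\<close>.\<close>

lemma solution_transform:
  assumes sol: "is_solution a U x y z w (\<lambda>t. t)"
    and eq: "\<And>t. t \<in> U \<Longrightarrow> X t = FX t \<and> Y t = FY t \<and> Z t = FZ t \<and> W t = FW t \<and> T t = FT t"
    and step: "\<And>t x' y' z' w'. \<lbrakk>t \<in> U; t \<noteq> 0; t - 1 \<noteq> 0;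
      (x has_field_derivative x') (at t); (y has_field_derivative y') (at t);
      (z has_field_derivative z') (at t); (w has_field_derivative w') (at t);
      flow a (x t) (y t) (z t) (w t) t x' y' z' w' 1\<rbrakk> \<Longrightarrow>
      FT t \<noteq> 0 \<and> FT t \<noteq> 1 \<and> (\<exists>X' Y' Z' W' T'. T' \<noteq> 0 \<and> (FT has_field_derivative T') (at t) \<and>
        (FX has_field_derivative X') (at t) \<and> (FY has_field_derivative Y') (at t) \<and>
        (FZ has_field_derivative Z') (at t) \<and> (FW has_field_derivative W') (at t) \<and>
        flow b (FX t) (FY t) (FZ t) (FW t) (FT t) X' Y' Z' W' T')"
  shows "is_solution b U X Y Z W T"
  unfolding is_solution_iff
proof (intro conjI ballI)
  show U: "open U" using sol by (simp add: is_solution_def)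
  fix t assume t: "t \<in> U"
  obtain x' y' z' w' T' where T': "((\<lambda>t. t) has_field_derivative T') (at t)"
    and t01: "t \<noteq> 0" "t \<noteq> 1" and d: "(x has_field_derivative x') (at t)"
        "(y has_field_derivative y') (at t)"
      "(z has_field_derivative z') (at t)" "(w has_field_derivative w') (at t)"
      "flow a (x t) (y t) (z t) (w t) t x' y' z' w' T'"
    using sol t unfolding is_solution_iff by metis
  have "T' = 1" using DERIV_unique[OF T' DERIV_ident] .
  then have "flow a (x t) (y t) (z t) (w t) t x' y' z' w' 1" using d by simp
  moreover have "t - 1 \<noteq> 0" using t01 by simp
  ultimately obtain X' Y' Z' W' T' where *: "T' \<noteq> 0" "(FT has_field_derivative T') (at t)"
    "(FX has_field_derivative X') (at t)" "(FY has_field_derivative Y') (at t)"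
    "(FZ has_field_derivative Z') (at t)" "(FW has_field_derivative W') (at t)"
    "flow b (FX t) (FY t) (FZ t) (FW t) (FT t) X' Y' Z' W' T'" "FT t \<noteq> 0" "FT t \<noteq> 1"
    using step[OF t t01(1) _ d(1-4)] by blast
  have transfer: "(F has_field_derivative D) (at t)"
    if "(G has_field_derivative D) (at t)" "\<And>t. t \<in> U \<Longrightarrow> F t = G t" for F G D
    using has_field_derivative_transform_within_open[OF that(1) U t] that(2) by simp
  show "T t \<noteq> 0" "T t \<noteq> 1" using * eq[OF t] by simp_all
  show "\<exists>X' Y' Z' W' T'. T' \<noteq> 0 \<and> (T has_field_derivative T') (at t) \<and>
        (X has_field_derivative X') (at t) \<and> (Y has_field_derivative Y') (at t) \<and>
        (Z has_field_derivative Z') (at t) \<and> (W has_field_derivative W') (at t) \<and>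
        flow b (X t) (Y t) (Z t) (W t) (T t) X' Y' Z' W' T'"
  proof (intro exI conjI)
    show "(T has_field_derivative T') (at t)" by (rule transfer[OF *(2)]) (simp add: eq)
    show "(X has_field_derivative X') (at t)" by (rule transfer[OF *(3)]) (simp add: eq)
    show "(Y has_field_derivative Y') (at t)" by (rule transfer[OF *(4)]) (simp add: eq)
    show "(Z has_field_derivative Z') (at t)" by (rule transfer[OF *(5)]) (simp add: eq)
    show "(W has_field_derivative W') (at t)" by (rule transfer[OF *(6)]) (simp add: eq)
  qed (use * eq[OF t] in simp_all)
qed

section \<open>Invariance of the vector field under each generator\<close>

lemma scale_derivative:
  fixes r :: "'a::field"
  assumes "r \<noteq> 0"
  shows "r * (c * (f + k * r * g / r\<^sup>2)) = r * (c * f) + k * (c * g)"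
    and "r * (c * (f - k * r * g / r\<^sup>2)) = r * (c * f) - k * (c * g)"
    and "r * (c * ((f * r - g * r) / r\<^sup>2)) = c * (f - g)"
  using assms by (simp_all add: field_simps power2_eq_square)

lemma flow_u1:
  fixes a b :: "nat \<Rightarrow> complex"
  assumes a6: "a 6 = 1/2 - (a 0 + a 1 + a 2 + a 3 + a 4 + a 5)"
    and b: "b 0 = a 0 + a 1" "b 1 = - a 1" "b 2 = a 2 + a 1" "b 3 = a 3" "b 4 = a 4" "b 5 = a 5"
        "b 6 = a 6"
    and nz: "x \<noteq> 0"
    and fl: "flow a x y z w t x' y' z' w' 1"
  shows "flow b x (y - a 1 / x) z w t
    x' (y' + a 1 * x' / x\<^sup>2) z' w' 1"
proof -
  have d: "t * (t - 1) * x' = Ham_y a x y z w t" "t * (t - 1) * y' = - Ham_x a x y z w t"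
    "t * (t - 1) * z' = Ham_w a x y z w t" "t * (t - 1) * w' = - Ham_z a x y z w t"
    using fl by (simp_all add: flow_def)
  obtain k where k: "a 1 = k * x"
    using nz by (metis nonzero_divide_eq_eq)
  have e: "y - a 1 / x = y - k"
    using k nz by simp_all
  have h0: "t * (t - 1) * x' = Ham_y b x (y - a 1 / x) z w t" "t * (t - 1) * z' =
      Ham_w b x (y - a 1 / x) z w t" "t * (t - 1) * w' = - Ham_z b x (y - a 1 / x) z w t"
    unfolding d e unfolding Ham_defs b a6 unfolding k by (simp_all add: algebra_simps power2_eq_square)
  \<comment> \<open>The derivative of \<open>y - k\<close> is \<open>y' + k * x' / x\<close>;
    multiplied by \<open>x\<close>, it is a combination of right-hand sides of the old system and so
    a polynomial.\<close>
  have "x * (t * (t - 1) * (y' + a 1 * x' / x\<^sup>2)) = x * (t * (t - 1) * y') + k * (t * (t - 1) * x')"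
    using nz unfolding k by (simp add: field_simps power2_eq_square)
  also have "\<dots> = x * (- Ham_x b x (y - a 1 / x) z w t)"
    unfolding d e unfolding Ham_defs b a6 unfolding k by (simp add: algebra_simps power2_eq_square)
  finally have h1: "t * (t - 1) * (y' + a 1 * x' / x\<^sup>2) = - Ham_x b x (y - a 1 / x) z w t"
    by (rule mult_left_cancel[THEN iffD1, rotated]) (use nz in simp)
  show ?thesis
    unfolding flow_def by (simp only: h0 h1 mult_1 mult_minus1 minus_minus simp_thms)
qed

text \<open>The roles of position and momentum are exchanged in comparison with
  \<open>flow_u1\<close>: a position is shifted by a function of its momentum.\<close>

lemma flow_u2:
  fixes a b :: "nat \<Rightarrow> complex"
  assumes a6: "a 6 = 1/2 - (a 0 + a 1 + a 2 + a 3 + a 4 + a 5)"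
    and b: "b 0 = a 0" "b 1 = a 1 + a 2" "b 2 = - a 2" "b 3 = a 3 + a 2" "b 4 = a 4" "b 5 = a 5"
        "b 6 = a 6"
    and nz: "y \<noteq> 0"
    and fl: "flow a x y z w t x' y' z' w' 1"
  shows "flow b (x + a 2 / y) y z w t
    (x' - a 2 * y' / y\<^sup>2) y' z' w' 1"
proof -
  have d: "t * (t - 1) * x' = Ham_y a x y z w t" "t * (t - 1) * y' = - Ham_x a x y z w t"
    "t * (t - 1) * z' = Ham_w a x y z w t" "t * (t - 1) * w' = - Ham_z a x y z w t"
    using fl by (simp_all add: flow_def)
  obtain k where k: "a 2 = k * y"
    using nz by (metis nonzero_divide_eq_eq)
  have e: "x + a 2 / y = x + k"
    using k nz by simp_all
  have h0: "t * (t - 1) * y' = - Ham_x b (x + a 2 / y) y z w t" "t * (t - 1) * z' =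
      Ham_w b (x + a 2 / y) y z w t" "t * (t - 1) * w' = - Ham_z b (x + a 2 / y) y z w t"
    unfolding d e unfolding Ham_defs b a6 unfolding k by (simp_all add: algebra_simps power2_eq_square)
  have "y * (t * (t - 1) * (x' - a 2 * y' / y\<^sup>2)) = y * (t * (t - 1) * x') - k * (t * (t - 1) * y')"
    using nz unfolding k by (simp add: field_simps power2_eq_square)
  also have "\<dots> = y * (Ham_y b (x + a 2 / y) y z w t)"
    unfolding d e unfolding Ham_defs b a6 unfolding k by (simp add: algebra_simps power2_eq_square)
  finally have h1: "t * (t - 1) * (x' - a 2 * y' / y\<^sup>2) = Ham_y b (x + a 2 / y) y z w t"
    by (rule mult_left_cancel[THEN iffD1, rotated]) (use nz in simp)
  show ?thesis
    unfolding flow_def by (simp only: h0 h1 mult_1 mult_minus1 minus_minus simp_thms)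
qed

text \<open>The momenta \<open>y\<close> and \<open>w\<close> are shifted by opposite amounts, so
  one \<open>k\<close> serves both equations, and \<open>x' - z'\<close> enters as the derivative of
  the common denominator.\<close>

lemma flow_u3:
  fixes a b :: "nat \<Rightarrow> complex"
  assumes a6: "a 6 = 1/2 - (a 0 + a 1 + a 2 + a 3 + a 4 + a 5)"
    and b: "b 0 = a 0" "b 1 = a 1" "b 2 = a 2 + a 3" "b 3 = - a 3" "b 4 = a 4 + a 3" "b 5 = a 5"
        "b 6 = a 6"
    and nz: "x - z \<noteq> 0"
    and fl: "flow a x y z w t x' y' z' w' 1"
  shows "flow b x (y - a 3 / (x - z)) z (w + a 3 / (x - z)) t
    x' (y' + a 3 * (x' - z') / (x - z)\<^sup>2) z' (w' - a 3 * (x' - z') / (x - z)\<^sup>2) 1"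
proof -
  have d: "t * (t - 1) * x' = Ham_y a x y z w t" "t * (t - 1) * y' = - Ham_x a x y z w t"
    "t * (t - 1) * z' = Ham_w a x y z w t" "t * (t - 1) * w' = - Ham_z a x y z w t"
    using fl by (simp_all add: flow_def)
  obtain k where k: "a 3 = k * (x - z)"
    using nz by (metis nonzero_divide_eq_eq)
  have e: "y - a 3 / (x - z) = y - k" "w + a 3 / (x - z) = w + k"
    using k nz by simp_all
  have h0: "t * (t - 1) * x' = Ham_y b x (y - a 3 / (x - z)) z (w + a 3 / (x - z)) t"
      "t * (t - 1) * z' = Ham_w b x (y - a 3 / (x - z)) z (w + a 3 / (x - z)) t"
    unfolding d e unfolding Ham_defs b a6 unfolding k by (simp_all add: algebra_simps power2_eq_square)
  have "(x - z) * (t * (t - 1) * (y' + a 3 * (x' - z') / (x - z)\<^sup>2)) =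
      (x - z) * (t * (t - 1) * y') + k * (t * (t - 1) * x' - t * (t - 1) * z')"
    unfolding k scale_derivative[OF nz] by (simp add: algebra_simps)
  also have "\<dots> = (x - z) * (- Ham_x b x (y - a 3 / (x - z)) z (w + a 3 / (x - z)) t)"
    unfolding d e unfolding Ham_defs b a6 unfolding k by (simp add: algebra_simps power2_eq_square)
  finally have h1: "t * (t - 1) * (y' + a 3 * (x' - z') / (x - z)\<^sup>2) =
      - Ham_x b x (y - a 3 / (x - z)) z (w + a 3 / (x - z)) t"
    by (rule mult_left_cancel[THEN iffD1, rotated]) (use nz in simp)
  have "(x - z) * (t * (t - 1) * (w' - a 3 * (x' - z') / (x - z)\<^sup>2)) =
      (x - z) * (t * (t - 1) * w') - k * (t * (t - 1) * x' - t * (t - 1) * z')"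
    unfolding k scale_derivative[OF nz] by (simp add: algebra_simps)
  also have "\<dots> = (x - z) * (- Ham_z b x (y - a 3 / (x - z)) z (w + a 3 / (x - z)) t)"
    unfolding d e unfolding Ham_defs b a6 unfolding k by (simp add: algebra_simps power2_eq_square)
  finally have h2: "t * (t - 1) * (w' - a 3 * (x' - z') / (x - z)\<^sup>2) =
      - Ham_z b x (y - a 3 / (x - z)) z (w + a 3 / (x - z)) t"
    by (rule mult_left_cancel[THEN iffD1, rotated]) (use nz in simp)
  show ?thesis
    unfolding flow_def by (simp only: h0 h1 h2 mult_1 mult_minus1 minus_minus simp_thms)
qed

text \<open>The shift turns \<open>(z - 1) * w\<close> in the coupling term into
  \<open>(z - 1) * w + a 4\<close>. The extra terms cancel against the first \<open>HVI\<close>,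
  whose parameter \<open>d3\<close> grows by \<open>2 * a 4\<close> while \<open>d4\<close> drops by
  the same amount.\<close>

lemma flow_u4:
  fixes a b :: "nat \<Rightarrow> complex"
  assumes a6: "a 6 = 1/2 - (a 0 + a 1 + a 2 + a 3 + a 4 + a 5)"
    and b: "b 0 = a 0" "b 1 = a 1" "b 2 = a 2" "b 3 = a 3 + a 4" "b 4 = - a 4" "b 5 = a 5 + a 4"
        "b 6 = a 6"
    and nz: "w \<noteq> 0"
    and fl: "flow a x y z w t x' y' z' w' 1"
  shows "flow b x y (z + a 4 / w) w t
    x' y' (z' - a 4 * w' / w\<^sup>2) w' 1"
proof -
  have d: "t * (t - 1) * x' = Ham_y a x y z w t" "t * (t - 1) * y' = - Ham_x a x y z w t"
    "t * (t - 1) * z' = Ham_w a x y z w t" "t * (t - 1) * w' = - Ham_z a x y z w t"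
    using fl by (simp_all add: flow_def)
  obtain k where k: "a 4 = k * w"
    using nz by (metis nonzero_divide_eq_eq)
  have e: "z + a 4 / w = z + k"
    using k nz by simp_all
  have h0: "t * (t - 1) * x' = Ham_y b x y (z + a 4 / w) w t" "t * (t - 1) * y' =
      - Ham_x b x y (z + a 4 / w) w t" "t * (t - 1) * w' = - Ham_z b x y (z + a 4 / w) w t"
    unfolding d e unfolding Ham_defs b a6 unfolding k by (simp_all add: algebra_simps power2_eq_square)
  have "w * (t * (t - 1) * (z' - a 4 * w' / w\<^sup>2)) = w * (t * (t - 1) * z') - k * (t * (t - 1) * w')"
    using nz unfolding k by (simp add: field_simps power2_eq_square)
  also have "\<dots> = w * (Ham_w b x y (z + a 4 / w) w t)"
    unfolding d e unfolding Ham_defs b a6 unfolding k by (simp add: algebra_simps power2_eq_square)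
  finally have h1: "t * (t - 1) * (z' - a 4 * w' / w\<^sup>2) = Ham_w b x y (z + a 4 / w) w t"
    by (rule mult_left_cancel[THEN iffD1, rotated]) (use nz in simp)
  show ?thesis
    unfolding flow_def by (simp only: h0 h1 mult_1 mult_minus1 minus_minus simp_thms)
qed

text \<open>The factors of \<open>a 4 * (a 4 + a 5)\<close> are exchanged, and
  \<open>a 3 + a 5 + 2 * a 6\<close>, \<open>a 3 + 2 * a 4 + a 5\<close> and
  \<open>a 5 + 2 * a 6\<close> are fixed, so the Hamiltonian itself does not change.\<close>

lemma flow_u5:
  fixes a b :: "nat \<Rightarrow> complex"
  assumes a6: "a 6 = 1/2 - (a 0 + a 1 + a 2 + a 3 + a 4 + a 5)"
    and b: "b 0 = a 0" "b 1 = a 1" "b 2 = a 2" "b 3 = a 3" "b 4 = a 4 + a 5" "b 5 = - a 5"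
        "b 6 = a 6 + a 5"
    and fl: "flow a x y z w t x' y' z' w' 1"
  shows "flow b x y z w t
    x' y' z' w' 1"
proof -
  have d: "t * (t - 1) * x' = Ham_y a x y z w t" "t * (t - 1) * y' = - Ham_x a x y z w t"
    "t * (t - 1) * z' = Ham_w a x y z w t" "t * (t - 1) * w' = - Ham_z a x y z w t"
    using fl by (simp_all add: flow_def)
  show ?thesis
    unfolding flow_def mult_1 d Ham_defs b a6 by (simp add: algebra_simps power2_eq_square)
qed

text \<open>Time is reversed, hence the velocity \<open>- 1\<close>, while
  \<open>t * (t - 1)\<close> is invariant under \<open>t -> 1 - t\<close>; this is what allows the
  old equations to be inserted into the new ones.\<close>

lemma flow_u0:
  fixes a b :: "nat \<Rightarrow> complex"
  assumes a6: "a 6 = 1/2 - (a 0 + a 1 + a 2 + a 3 + a 4 + a 5)"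
    and b: "b 0 = - a 0" "b 1 = a 1 + 2 * a 0" "b 2 = a 2" "b 3 = a 3" "b 4 = a 4" "b 5 = a 5"
        "b 6 = a 6"
    and nz: "t \<noteq> 0" "t - 1 \<noteq> 0"
    and fl: "flow a x y z w t x' y' z' w' 1"
  shows "flow b ((t * x - 1) / (t - 1)) ((t - 1) * y / t) ((t * z - 1) / (t - 1)) ((t - 1) * w / t)
      (1 - t)
    (((x + t * x') * (t - 1) - (t * x - 1)) / (t - 1)\<^sup>2)
    (y / t\<^sup>2 + (t - 1) / t * y')
    (((z + t * z') * (t - 1) - (t * z - 1)) / (t - 1)\<^sup>2)
    (w / t\<^sup>2 + (t - 1) / t * w') (- 1)"
proof -
  have d: "t * (t - 1) * x' = Ham_y a x y z w t" "t * (t - 1) * y' = - Ham_x a x y z w t"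
    "t * (t - 1) * z' = Ham_w a x y z w t" "t * (t - 1) * w' = - Ham_z a x y z w t"
    using fl by (simp_all add: flow_def)
  txt \<open>In these coordinates both the old and the new variables are polynomial.\<close>
  obtain r where r: "x = 1 + r * (t - 1)"
    using nz by (metis add.commute diff_add_cancel nonzero_divide_eq_eq)
  obtain s where s: "z = 1 + s * (t - 1)"
    using nz by (metis add.commute diff_add_cancel nonzero_divide_eq_eq)
  obtain p where p: "y = t * p"
    using nz by (metis nonzero_mult_div_cancel_left times_divide_eq_right)
  obtain q where q: "w = t * q"
    using nz by (metis nonzero_mult_div_cancel_left times_divide_eq_right)
  have e: "(t * x - 1) / (t - 1) = 1 + r * t" "(t * z - 1) / (t - 1) = 1 + s * t"
      "(t - 1) * y / t = (t - 1) * p" "(t - 1) * w / t = (t - 1) * q"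
    using nz unfolding r s p q by (simp_all add: field_simps)
  have num: "t * x - 1 = (1 + r * t) * (t - 1)" "t * z - 1 = (1 + s * t) * (t - 1)"
    unfolding r s by (simp_all add: algebra_simps)
  \<comment> \<open>The summand with \<open>r\<close> is what remains of the explicit dependence of
    the new position on \<open>t\<close>.\<close>
  have "(t - 1) * ((1 - t) * (1 - t - 1) * (((x + t * x') * (t - 1) - (t * x - 1)) / (t - 1)\<^sup>2)) =
      t * (t * (t - 1) * x') - t * (t - 1) * r"
    unfolding num scale_derivative[OF nz(2)] by (simp add: algebra_simps r)
  also have "\<dots> = (t - 1) * (- Ham_y b ((t * x - 1) / (t - 1)) ((t - 1) * y / t) ((t * z - 1) /
      (t - 1)) ((t - 1) * w / t) (1 - t))"
    unfolding d e Ham_defs b a6 unfolding r s p q by (simp add: algebra_simps power2_eq_square)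
  finally have h1: "(1 - t) * (1 - t - 1) * (((x + t * x') * (t - 1) - (t * x - 1)) / (t - 1)\<^sup>2) =
      - Ham_y b ((t * x - 1) / (t - 1)) ((t - 1) * y / t) ((t * z - 1) / (t - 1)) ((t - 1) * w / t)
      (1 - t)"
    by (rule mult_left_cancel[THEN iffD1, rotated]) (use nz in simp)
  have "t * ((1 - t) * (1 - t - 1) * (y / t\<^sup>2 + (t - 1) / t * y')) =
      (t - 1) * (t * (t - 1) * y') + t * (t - 1) * p"
    using nz unfolding p by (simp add: field_simps power2_eq_square)
  also have "\<dots> = t * (Ham_x b ((t * x - 1) / (t - 1)) ((t - 1) * y / t) ((t * z - 1) / (t - 1))
      ((t - 1) * w / t) (1 - t))"
    unfolding d e Ham_defs b a6 unfolding r s p q by (simp add: algebra_simps power2_eq_square)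
  finally have h2: "(1 - t) * (1 - t - 1) * (y / t\<^sup>2 + (t - 1) / t * y') =
      Ham_x b ((t * x - 1) / (t - 1)) ((t - 1) * y / t) ((t * z - 1) / (t - 1)) ((t - 1) * w / t) (1
      - t)"
    by (rule mult_left_cancel[THEN iffD1, rotated]) (use nz in simp)
  have "(t - 1) * ((1 - t) * (1 - t - 1) * (((z + t * z') * (t - 1) - (t * z - 1)) / (t - 1)\<^sup>2)) =
      t * (t * (t - 1) * z') - t * (t - 1) * s"
    unfolding num scale_derivative[OF nz(2)] by (simp add: algebra_simps s)
  also have "\<dots> = (t - 1) * (- Ham_w b ((t * x - 1) / (t - 1)) ((t - 1) * y / t) ((t * z - 1) /
      (t - 1)) ((t - 1) * w / t) (1 - t))"
    unfolding d e Ham_defs b a6 unfolding r s p q by (simp add: algebra_simps power2_eq_square)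
  finally have h3: "(1 - t) * (1 - t - 1) * (((z + t * z') * (t - 1) - (t * z - 1)) / (t - 1)\<^sup>2) =
      - Ham_w b ((t * x - 1) / (t - 1)) ((t - 1) * y / t) ((t * z - 1) / (t - 1)) ((t - 1) * w / t)
      (1 - t)"
    by (rule mult_left_cancel[THEN iffD1, rotated]) (use nz in simp)
  have "t * ((1 - t) * (1 - t - 1) * (w / t\<^sup>2 + (t - 1) / t * w')) =
      (t - 1) * (t * (t - 1) * w') + t * (t - 1) * q"
    using nz unfolding q by (simp add: field_simps power2_eq_square)
  also have "\<dots> = t * (Ham_z b ((t * x - 1) / (t - 1)) ((t - 1) * y / t) ((t * z - 1) / (t - 1))
      ((t - 1) * w / t) (1 - t))"
    unfolding d e Ham_defs b a6 unfolding r s p q by (simp add: algebra_simps power2_eq_square)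
  finally have h4: "(1 - t) * (1 - t - 1) * (w / t\<^sup>2 + (t - 1) / t * w') =
      Ham_z b ((t * x - 1) / (t - 1)) ((t - 1) * y / t) ((t * z - 1) / (t - 1)) ((t - 1) * w / t) (1
      - t)"
    by (rule mult_left_cancel[THEN iffD1, rotated]) (use nz in simp)
  show ?thesis
    unfolding flow_def by (simp only: h1 h2 h3 h4 mult_1 mult_minus1 minus_minus simp_thms)
qed

lemma flow_u6:
  fixes a b :: "nat \<Rightarrow> complex"
  assumes a6: "a 6 = 1/2 - (a 0 + a 1 + a 2 + a 3 + a 4 + a 5)"
    and b: "b 0 = a 0" "b 1 = a 1" "b 2 = a 2" "b 3 = a 3" "b 4 = a 4" "b 5 = a 5 + 2 * a 6"
        "b 6 = - a 6"
    and nz: "x - 1 \<noteq> 0" "z - 1 \<noteq> 0"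
    and fl: "flow a x y z w t x' y' z' w' 1"
  shows "flow b (x / (x - 1)) (- (x - 1) * ((x - 1) * y + a 2)) (z / (z - 1)) (- (z - 1) *
      ((z - 1) * w + a 4)) (1 - t)
    (- x' / (x - 1)\<^sup>2)
    (- (x' * ((x - 1) * y + a 2) + (x - 1) * (x' * y + (x - 1) * y')))
    (- z' / (z - 1)\<^sup>2)
    (- (z' * ((z - 1) * w + a 4) + (z - 1) * (z' * w + (z - 1) * w'))) (- 1)"
proof -
  have d: "t * (t - 1) * x' = Ham_y a x y z w t" "t * (t - 1) * y' = - Ham_x a x y z w t"
    "t * (t - 1) * z' = Ham_w a x y z w t" "t * (t - 1) * w' = - Ham_z a x y z w t"
    using fl by (simp_all add: flow_def)
  \<comment> \<open>After the shift the denominators are the single variables \<open>r\<close> and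
    \<open>s\<close>, and clearing them leaves polynomial identities.\<close>
  obtain r where r: "x = 1 + r" by (metis add.commute diff_add_cancel)
  obtain s where s: "z = 1 + s" by (metis add.commute diff_add_cancel)
  have rs: "r \<noteq> 0" "s \<noteq> 0" using nz by (simp_all add: r s)
  have "(1 - t) * (1 - t - 1) * (- x' / (x - 1)\<^sup>2) = - (t * (t - 1) * x') / (x - 1)\<^sup>2"
    by (simp add: divide_inverse algebra_simps)
  also have "\<dots> = - Ham_y b (x / (x - 1)) (- (x - 1) * ((x - 1) * y + a 2)) (z / (z - 1)) (-
      (z - 1) * ((z - 1) * w + a 4)) (1 - t)"
    unfolding d unfolding Ham_defs b a6 r s using rs
    by (simp add: divide_simps; simp add: algebra_simps power2_eq_square)
  finally have h1: "(1 - t) * (1 - t - 1) * (- x' / (x - 1)\<^sup>2) = - Ham_y b (x / (x - 1)) (- (x - 1) *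
      ((x - 1) * y + a 2)) (z / (z - 1)) (- (z - 1) * ((z - 1) * w + a 4)) (1 - t)" .
  have "(1 - t) * (1 - t - 1) * (- (x' * ((x - 1) * y + a 2) + (x - 1) * (x' * y + (x - 1) * y'))) =
      - ((t * (t - 1) * x') * ((x - 1) * y + a 2) +
        (x - 1) * ((t * (t - 1) * x') * y + (x - 1) * (t * (t - 1) * y')))"
    by (simp add: algebra_simps)
  also have "\<dots> = Ham_x b (x / (x - 1)) (- (x - 1) * ((x - 1) * y + a 2)) (z / (z - 1)) (- (z - 1) *
      ((z - 1) * w + a 4)) (1 - t)"
    unfolding d unfolding Ham_defs b a6 r s using rs
    by (simp add: divide_simps; simp add: algebra_simps power2_eq_square)
  finally have h2: "(1 - t) * (1 - t - 1) * (- (x' * ((x - 1) * y + a 2) + (x - 1) * (x' * y +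
      (x - 1) * y'))) = Ham_x b (x / (x - 1)) (- (x - 1) * ((x - 1) * y + a 2)) (z / (z - 1)) (- (z
      - 1) * ((z - 1) * w + a 4)) (1 - t)" .
  have "(1 - t) * (1 - t - 1) * (- z' / (z - 1)\<^sup>2) = - (t * (t - 1) * z') / (z - 1)\<^sup>2"
    by (simp add: divide_inverse algebra_simps)
  also have "\<dots> = - Ham_w b (x / (x - 1)) (- (x - 1) * ((x - 1) * y + a 2)) (z / (z - 1)) (-
      (z - 1) * ((z - 1) * w + a 4)) (1 - t)"
    unfolding d unfolding Ham_defs b a6 r s using rs
    by (simp add: divide_simps; simp add: algebra_simps power2_eq_square)
  finally have h3: "(1 - t) * (1 - t - 1) * (- z' / (z - 1)\<^sup>2) = - Ham_w b (x / (x - 1)) (- (x - 1) *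
      ((x - 1) * y + a 2)) (z / (z - 1)) (- (z - 1) * ((z - 1) * w + a 4)) (1 - t)" .
  have "(1 - t) * (1 - t - 1) * (- (z' * ((z - 1) * w + a 4) + (z - 1) * (z' * w + (z - 1) * w'))) =
      - ((t * (t - 1) * z') * ((z - 1) * w + a 4) +
        (z - 1) * ((t * (t - 1) * z') * w + (z - 1) * (t * (t - 1) * w')))"
    by (simp add: algebra_simps)
  also have "\<dots> = Ham_z b (x / (x - 1)) (- (x - 1) * ((x - 1) * y + a 2)) (z / (z - 1)) (- (z - 1) *
      ((z - 1) * w + a 4)) (1 - t)"
    unfolding d unfolding Ham_defs b a6 r s using rs
    by (simp add: divide_simps; simp add: algebra_simps power2_eq_square)
  finally have h4: "(1 - t) * (1 - t - 1) * (- (z' * ((z - 1) * w + a 4) + (z - 1) * (z' * w +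
      (z - 1) * w'))) = Ham_z b (x / (x - 1)) (- (x - 1) * ((x - 1) * y + a 2)) (z / (z - 1)) (- (z
      - 1) * ((z - 1) * w + a 4)) (1 - t)" .
  show ?thesis
    unfolding flow_def by (simp only: h1 h2 h3 h4 mult_1 mult_minus1 minus_minus simp_thms)
qed

text \<open>The new first canonical pair is built from the old second one and conversely, so the old
  equations for \<open>z\<close> and \<open>w\<close> yield those with \<open>Ham_y\<close> and
  \<open>Ham_x\<close>. Summands such as \<open>t * (t - 1) * z\<close> come from the explicit
  factor \<open>t\<close> in the new coordinates.\<close>

lemma flow_\<phi>:
  fixes a b :: "nat \<Rightarrow> complex"
  assumes a6: "a 6 = 1/2 - (a 0 + a 1 + a 2 + a 3 + a 4 + a 5)"
    and b: "b 0 = a 6" "b 1 = a 5" "b 2 = a 4" "b 3 = a 3" "b 4 = a 2" "b 5 = a 1" "b 6 = a 0"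
    and nz: "x \<noteq> 0" "z \<noteq> 0" "t \<noteq> 0"
    and fl: "flow a x y z w t x' y' z' w' 1"
  shows "flow b (1 / (t * z)) (- t * z * (z * w + a 4)) (1 / (t * x)) (- t * x * (x * y + a 2)) t
    (- (z + t * z') / (t * z)\<^sup>2)
    (- ((z + t * z') * (z * w + a 4) + t * z * (z' * w + z * w')))
    (- (x + t * x') / (t * x)\<^sup>2)
    (- ((x + t * x') * (x * y + a 2) + t * x * (x' * y + x * y'))) 1"
proof -
  have d: "t * (t - 1) * x' = Ham_y a x y z w t" "t * (t - 1) * y' = - Ham_x a x y z w t"
    "t * (t - 1) * z' = Ham_w a x y z w t" "t * (t - 1) * w' = - Ham_z a x y z w t"
    using fl by (simp_all add: flow_def)
  have "t * (t - 1) * (- (z + t * z') / (t * z)\<^sup>2) = - (t * (t - 1) * z + t * (t * (t - 1) * z')) /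
      (t * z)\<^sup>2"
    by (simp add: algebra_simps)
  also have "\<dots> = Ham_y b (1 / (t * z)) (- t * z * (z * w + a 4)) (1 / (t * x)) (- t * x * (x * y + a
      2)) t"
    unfolding d unfolding Ham_defs b a6 using nz
    by (simp add: divide_simps; simp add: algebra_simps power2_eq_square)
  finally have h1: "t * (t - 1) * (- (z + t * z') / (t * z)\<^sup>2) = Ham_y b (1 / (t * z)) (- t * z *
      (z * w + a 4)) (1 / (t * x)) (- t * x * (x * y + a 2)) t" .
  have "t * (t - 1) * (- ((z + t * z') * (z * w + a 4) + t * z * (z' * w + z * w'))) =
      - ((t * (t - 1) * z + t * (t * (t - 1) * z')) * (z * w + a 4) +
        t * z * ((t * (t - 1) * z') * w + z * (t * (t - 1) * w')))"
    by (simp add: algebra_simps)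
  also have "\<dots> = - Ham_x b (1 / (t * z)) (- t * z * (z * w + a 4)) (1 / (t * x)) (- t * x *
      (x * y + a 2)) t"
    unfolding d unfolding Ham_defs b a6 using nz
    by (simp add: divide_simps; simp add: algebra_simps power2_eq_square)
  finally have h2: "t * (t - 1) * (- ((z + t * z') * (z * w + a 4) + t * z * (z' * w + z * w'))) =
      - Ham_x b (1 / (t * z)) (- t * z * (z * w + a 4)) (1 / (t * x)) (- t * x * (x * y + a 2)) t" .
  have "t * (t - 1) * (- (x + t * x') / (t * x)\<^sup>2) = - (t * (t - 1) * x + t * (t * (t - 1) * x')) /
      (t * x)\<^sup>2"
    by (simp add: algebra_simps)
  also have "\<dots> = Ham_w b (1 / (t * z)) (- t * z * (z * w + a 4)) (1 / (t * x)) (- t * x * (x * y + a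
      2)) t"
    unfolding d unfolding Ham_defs b a6 using nz
    by (simp add: divide_simps; simp add: algebra_simps power2_eq_square)
  finally have h3: "t * (t - 1) * (- (x + t * x') / (t * x)\<^sup>2) = Ham_w b (1 / (t * z)) (- t * z *
      (z * w + a 4)) (1 / (t * x)) (- t * x * (x * y + a 2)) t" .
  have "t * (t - 1) * (- ((x + t * x') * (x * y + a 2) + t * x * (x' * y + x * y'))) =
      - ((t * (t - 1) * x + t * (t * (t - 1) * x')) * (x * y + a 2) +
        t * x * ((t * (t - 1) * x') * y + x * (t * (t - 1) * y')))"
    by (simp add: algebra_simps)
  also have "\<dots> = - Ham_z b (1 / (t * z)) (- t * z * (z * w + a 4)) (1 / (t * x)) (- t * x *
      (x * y + a 2)) t"
    unfolding d unfolding Ham_defs b a6 using nz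
    by (simp add: divide_simps; simp add: algebra_simps power2_eq_square)
  finally have h4: "t * (t - 1) * (- ((x + t * x') * (x * y + a 2) + t * x * (x' * y + x * y'))) =
      - Ham_z b (1 / (t * z)) (- t * z * (z * w + a 4)) (1 / (t * x)) (- t * x * (x * y + a 2)) t" .
  show ?thesis
    unfolding flow_def by (simp only: h1 h2 h3 h4 mult_1 mult_minus1 minus_minus simp_thms)
qed

subsection \<open>The transformations preserve the system\<close>

lemma has_value_unique: "has_value f p c \<Longrightarrow> has_value f p c' \<Longrightarrow> c = c'"
  unfolding has_value_conv_val by (rule complex_const.peval.val_unique)

lemma has_value_rvar: "p v = c \<Longrightarrow> has_value (rvar v) p c"
  unfolding has_value_conv_val using complex_const.val_rvar by blast

lemmas has_value_rconst = complex_const.val_rconst[folded has_value_conv_val]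
lemmas has_value_arith = complex_const.peval.val_intros[folded has_value_conv_val]

text \<open>A point stores the values \<open>a 0\<close> to \<open>a 5\<close>; the normalisation of
  the sum supplies the case \<open>i = 6\<close>.\<close>

lemma has_value_par:
  assumes "(\<Sum>i\<le>6. a i) = 1/2" "i \<le> 6"
  shows "has_value (par i) (point x y z w t a) (a i)"
proof -
  have a6: "a 6 = 1/2 - (a 0 + a 1 + a 2 + a 3 + a 4 + a 5)"
    using assms(1) by (simp add: eval_nat_numeral algebra_simps)
  consider "i = 0" | "i = 1" | "i = 2" | "i = 3" | "i = 4" | "i = 5" | "i = 6" using assms(2)
      by linarith
  then show ?thesis
    by cases (simp_all only: par_simps a6, (intro has_value_arith has_value_rvar has_value_rconst;
        simp)+)
qed

section \<open>Exclusion of poles\<close>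

lemma isCont_poly_eval: "isCont (\<lambda>c. poly_eval (p(v := c)) f) b"
  unfolding poly_eval_conv_peval
proof (induction f rule: cpoly_induct)
  case (var v')
  show ?case unfolding complex_const.peval_var by (cases "v' = v") simp_all
qed (simp_all add: complex_const.peval_const complex_const.peval_add complex_const.peval_mult)

text \<open>A pole whose coefficient is a parameter must be excluded even where that parameter vanishes;
  moving the parameter away from \<open>0\<close> keeps the function regular.\<close>

lemma has_value_perturb:
  assumes "has_value f p c"
  obtains b c' where "b \<noteq> 0" "has_value f (p(v := b)) c'"
proof -
  obtain n d where nd: "f = Fract n d" "poly_eval p d \<noteq> 0"
    using assms unfolding has_value_def by blast
  have "((\<lambda>b. poly_eval (p(v := b)) d) \<longlongrightarrow> poly_eval p d) (at (p v))"
    using isCont_poly_eval[where p = p and v = v and f = d and b = "p v"] by (simp add: isCont_def)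
  then have "\<forall>\<^sub>F b in at (p v). poly_eval (p(v := b)) d \<noteq> 0"
    using nd(2) by (rule tendsto_imp_eventually_ne)
  moreover have "\<forall>\<^sub>F b in at (p v). b \<noteq> 0"
    by (rule eventually_neq_at_within)
  ultimately have "\<forall>\<^sub>F b in at (p v). poly_eval (p(v := b)) d \<noteq> 0 \<and> b \<noteq> 0"
    by (rule eventually_conj)
  then obtain b where "poly_eval (p(v := b)) d \<noteq> 0" "b \<noteq> 0"
    using eventually_happens'[OF at_neq_bot] by blast
  then show thesis
    using that nd(1) unfolding has_value_def by blast
qed

text \<open>If \<open>f\<close> were regular at a zero of \<open>g\<close>, the product
  \<open>k\<close> would vanish there.\<close>

lemma has_value_pole:
  assumes "has_value f p c" "f * g = k" "has_value g p 0" "has_value k p c'" "c' \<noteq> 0"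
  shows False
  using has_value_unique[OF has_value_arith(2)[OF assms(1,3)], of c'] assms by simp

text \<open>Here \<open>k\<close> reduces to the parameter \<open>v\<close> on the zero set of
  \<open>g\<close>. At the perturbed point its value is the nonzero \<open>b\<close>, although
  \<open>g\<close> still vanishes.\<close>

lemma has_value_generic_pole:
  assumes "has_value f p c" "f * g = k"
    and "\<And>b. has_value g (p(v := b)) 0" "\<And>b. has_value k (p(v := b)) b"
  shows False
  using has_value_perturb[OF assms(1), of v] has_value_pole[OF _ assms(2-4)] by metis

lemma images_conv: "images s = (s \<^bold>x, s \<^bold>y, s \<^bold>z, s \<^bold>w, s \<^bold>t,
    [s (par 0), s (par 1), s (par 2), s (par 3), s (par 4), s (par 5), s (par 6)])"
proof -
  have "[0..<7] = [0, 1, 2, 3, 4, 5, 6]"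
    by (simp add: upt_rec)
  then show ?thesis
    by (simp add: images_def)
qed

text \<open>Separates computing a value from simplifying it: the first premise instantiates
  \<open>b\<close> from the structure of \<open>f\<close>, and the equation is solved
  afterwards.\<close>

lemma has_value_eqI:
  assumes "has_value f p b"
  shows "b = c \<Longrightarrow> has_value f p c"
  using assms by simp

lemma baecklundI:
  assumes s: "field_hom s" "s \<circ> s = id"
    and img: "images s = (fx, fy, fz, fw, ft, [f0, f1, f2, f3, f4, f5, f6])"
    and par: "{f0, f1, f2, f3, f4, f5} \<subseteq> par_field"
    and tr: "\<And>a b U x y z w X Y Z W T p t\<^sub>0.
      \<lbrakk>a 6 = 1/2 - (a 0 + a 1 + a 2 + a 3 + a 4 + a 5); is_solution a U x y z w (\<lambda>t. t);
       \<And>t. p t = point (x t) (y t) (z t) (w t) t a; \<And>t. t \<in> U \<Longrightarrow> t \<noteq> 0 \<and> t - 1 \<noteq> 0;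
       \<And>i t. i \<le> 6 \<Longrightarrow> has_value (\<^bold>\<alpha> i) (p t) (a i);
       \<And>t. t \<in> U \<Longrightarrow> has_value fx (p t) (X t); \<And>t. t \<in> U \<Longrightarrow> has_value fy (p t) (Y t);
       \<And>t. t \<in> U \<Longrightarrow> has_value fz (p t) (Z t); \<And>t. t \<in> U \<Longrightarrow> has_value fw (p t) (W t);
       \<And>t. t \<in> U \<Longrightarrow> has_value ft (p t) (T t);
       has_value f0 (p t\<^sub>0) (b 0); has_value f1 (p t\<^sub>0) (b 1); has_value f2 (p t\<^sub>0) (b 2);
       has_value f3 (p t\<^sub>0) (b 3); has_value f4 (p t\<^sub>0) (b 4); has_value f5 (p t\<^sub>0) (b 5);
       has_value f6 (p t\<^sub>0) (b 6)\<rbrakk> \<Longrightarrow> is_solution b U X Y Z W T"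
  shows "baecklund s"
  unfolding baecklund_def
proof (intro conjI allI impI)
  show "field_automorphism s"
    using s by (rule field_automorphism_involution)
  have im: "s \<^bold>x = fx" "s \<^bold>y = fy" "s \<^bold>z = fz" "s \<^bold>w = fw" "s \<^bold>t = ft" "s (par 0) = f0" "s (par 1) = f1"
    "s (par 2) = f2" "s (par 3) = f3" "s (par 4) = f4" "s (par 5) = f5" "s (par 6) = f6"
    using img unfolding images_conv by simp_all
  show "s ` par_field = par_field"
  proof (rule par_field_image[OF s])
    fix i :: nat assume "i \<le> 5"
    then consider "i = 0" | "i = 1" | "i = 2" | "i = 3" | "i = 4" | "i = 5" by linarith
    then show "s (par i) \<in> par_field"
      using par im by cases simp_all
  qed
  fix a b U x y z w X Y Z W T
  assume *: "(\<Sum>i\<le>6. a i) = 1/2 \<and> is_solution a U x y z w (\<lambda>t. t) \<and>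
      (\<forall>t\<in>U. let p = point (x t) (y t) (z t) (w t) t a in
        has_value (s \<^bold>x) p (X t) \<and> has_value (s \<^bold>y) p (Y t) \<and>
        has_value (s \<^bold>z) p (Z t) \<and> has_value (s \<^bold>w) p (W t) \<and>
        has_value (s \<^bold>t) p (T t) \<and> (\<forall>i\<le>6. has_value (s (\<^bold>\<alpha> i)) p (b i)))"
  show "is_solution b U X Y Z W T"
  \<comment> \<open>On the empty set the assumptions say nothing about \<open>b\<close>, but
    \<open>is_solution\<close> holds vacuously. Otherwise a single point of \<open>U\<close>
    determines the new parameters, since they are constant.\<close>
  proof (cases "U = {}")
    case True
    then show ?thesis by (simp add: is_solution_def)
  next
    case False
    then obtain t\<^sub>0 where t0: "t\<^sub>0 \<in> U" by blast
    define p where "p t = point (x t) (y t) (z t) (w t) t a" for t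
    have v: "has_value fx (p t) (X t)" "has_value fy (p t) (Y t)" "has_value fz (p t) (Z t)"
      "has_value fw (p t) (W t)" "has_value ft (p t) (T t)"
          "\<And>i. i \<le> 6 \<Longrightarrow> has_value (s (\<^bold>\<alpha> i)) (p t) (b i)"
      if "t \<in> U" for t
      using * that unfolding Let_def im p_def by blast+
    show ?thesis
    proof (rule tr[of a U x y z w p X Y Z W T t\<^sub>0 b])
      show "a 6 = 1/2 - (a 0 + a 1 + a 2 + a 3 + a 4 + a 5)"
        using * by (simp add: eval_nat_numeral algebra_simps)
      show "t \<noteq> 0 \<and> t - 1 \<noteq> 0" if "t \<in> U" for t
        using * that unfolding is_solution_def by simp
      show "has_value (\<^bold>\<alpha> i) (p t) (a i)" if "i \<le> 6" for i t
        unfolding p_def using * that by (intro has_value_par) auto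
      show "has_value f0 (p t\<^sub>0) (b 0)" "has_value f1 (p t\<^sub>0) (b 1)" "has_value f2 (p t\<^sub>0) (b 2)"
        "has_value f3 (p t\<^sub>0) (b 3)" "has_value f4 (p t\<^sub>0) (b 4)" "has_value f5 (p t\<^sub>0) (b 5)"
        "has_value f6 (p t\<^sub>0) (b 6)"
        using v(6)[OF t0, of 0] v(6)[OF t0, of 1] v(6)[OF t0, of 2] v(6)[OF t0, of 3] v(6)[OF t0, of 4]
          v(6)[OF t0, of 5] v(6)[OF t0, of 6]
        unfolding im by simp_all
    qed (use * v(1-5) p_def in blast)+
  qed
qed

section \<open>The generators as Baecklund transformations\<close>

lemma images_u0: "images (u 0) =
  ((\<^bold>t * \<^bold>x - 1) / (\<^bold>t - 1), (\<^bold>t - 1) * \<^bold>y / \<^bold>t, (\<^bold>t * \<^bold>z - 1) / (\<^bold>t - 1), (\<^bold>t - 1) * \<^bold>w / \<^bold>t, 1 - \<^bold>t,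
   [- \<^bold>\<alpha> 0, \<^bold>\<alpha> 1 + 2 * \<^bold>\<alpha> 0, \<^bold>\<alpha> 2, \<^bold>\<alpha> 3, \<^bold>\<alpha> 4, \<^bold>\<alpha> 5, \<^bold>\<alpha> 6])"
  by (simp add: images_conv u_eval algebra_simps)

lemma images_u1: "images (u 1) =
  (\<^bold>x, \<^bold>y - \<^bold>\<alpha> 1 / \<^bold>x, \<^bold>z, \<^bold>w, \<^bold>t,
   [\<^bold>\<alpha> 0 + \<^bold>\<alpha> 1, - \<^bold>\<alpha> 1, \<^bold>\<alpha> 2 + \<^bold>\<alpha> 1, \<^bold>\<alpha> 3, \<^bold>\<alpha> 4, \<^bold>\<alpha> 5, \<^bold>\<alpha> 6])"
  by (simp add: images_conv u_eval algebra_simps)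

lemma images_u2: "images (u 2) =
  (\<^bold>x + \<^bold>\<alpha> 2 / \<^bold>y, \<^bold>y, \<^bold>z, \<^bold>w, \<^bold>t,
   [\<^bold>\<alpha> 0, \<^bold>\<alpha> 1 + \<^bold>\<alpha> 2, - \<^bold>\<alpha> 2, \<^bold>\<alpha> 3 + \<^bold>\<alpha> 2, \<^bold>\<alpha> 4, \<^bold>\<alpha> 5, \<^bold>\<alpha> 6])"
  by (simp add: images_conv u_eval algebra_simps)

lemma images_u3: "images (u 3) =
  (\<^bold>x, \<^bold>y - \<^bold>\<alpha> 3 / (\<^bold>x - \<^bold>z), \<^bold>z, \<^bold>w + \<^bold>\<alpha> 3 / (\<^bold>x - \<^bold>z), \<^bold>t,
   [\<^bold>\<alpha> 0, \<^bold>\<alpha> 1, \<^bold>\<alpha> 2 + \<^bold>\<alpha> 3, - \<^bold>\<alpha> 3, \<^bold>\<alpha> 4 + \<^bold>\<alpha> 3, \<^bold>\<alpha> 5, \<^bold>\<alpha> 6])"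
  by (simp add: images_conv u_eval algebra_simps)

lemma images_u4: "images (u 4) =
  (\<^bold>x, \<^bold>y, \<^bold>z + \<^bold>\<alpha> 4 / \<^bold>w, \<^bold>w, \<^bold>t,
   [\<^bold>\<alpha> 0, \<^bold>\<alpha> 1, \<^bold>\<alpha> 2, \<^bold>\<alpha> 3 + \<^bold>\<alpha> 4, - \<^bold>\<alpha> 4, \<^bold>\<alpha> 5 + \<^bold>\<alpha> 4, \<^bold>\<alpha> 6])"
  by (simp add: images_conv u_eval algebra_simps)

lemma images_u5: "images (u 5) =
  (\<^bold>x, \<^bold>y, \<^bold>z, \<^bold>w, \<^bold>t,
   [\<^bold>\<alpha> 0, \<^bold>\<alpha> 1, \<^bold>\<alpha> 2, \<^bold>\<alpha> 3, \<^bold>\<alpha> 4 + \<^bold>\<alpha> 5, - \<^bold>\<alpha> 5, \<^bold>\<alpha> 6 + \<^bold>\<alpha> 5])"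
  by (simp add: images_conv u_eval algebra_simps)

lemma images_u6: "images (u 6) =
  (\<^bold>x / (\<^bold>x - 1), - (\<^bold>x - 1) * ((\<^bold>x - 1) * \<^bold>y + \<^bold>\<alpha> 2), \<^bold>z / (\<^bold>z - 1), - (\<^bold>z - 1) * ((\<^bold>z - 1) * \<^bold>w + \<^bold>\<alpha> 4), 1 - \<^bold>t,
   [\<^bold>\<alpha> 0, \<^bold>\<alpha> 1, \<^bold>\<alpha> 2, \<^bold>\<alpha> 3, \<^bold>\<alpha> 4, \<^bold>\<alpha> 5 + 2 * \<^bold>\<alpha> 6, - \<^bold>\<alpha> 6])"
  by (simp add: images_conv u_eval algebra_simps)

lemma images_\<phi>: "images (\<phi>) =
  (1 / (\<^bold>t * \<^bold>z), - \<^bold>t * \<^bold>z * (\<^bold>z * \<^bold>w + \<^bold>\<alpha> 4), 1 / (\<^bold>t * \<^bold>x), - \<^bold>t * \<^bold>x * (\<^bold>x * \<^bold>y + \<^bold>\<alpha> 2), \<^bold>t,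
   [\<^bold>\<alpha> 6, \<^bold>\<alpha> 5, \<^bold>\<alpha> 4, \<^bold>\<alpha> 3, \<^bold>\<alpha> 2, \<^bold>\<alpha> 1, \<^bold>\<alpha> 0])"
  by (simp add: images_conv \<phi>.simps \<phi>_rvar par_simps)

text \<open>The denominators \<open>t\<close> and \<open>t - 1\<close> are nonzero along every
  solution, so the values of the images can be computed directly.\<close>

lemma baecklund_u0: "baecklund (u 0)"
proof (rule baecklundI[OF u.field_hom_axioms u_u images_u0])
  show "{- \<^bold>\<alpha> 0, \<^bold>\<alpha> 1 + 2 * \<^bold>\<alpha> 0, \<^bold>\<alpha> 2, \<^bold>\<alpha> 3, \<^bold>\<alpha> 4, \<^bold>\<alpha> 5} \<subseteq> par_field"
    by (simp add: par_field_intros)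
  fix a b :: "nat \<Rightarrow> complex" and U :: "complex set" and x y z w X Y Z W T :: "complex \<Rightarrow> complex"
    and p :: "complex \<Rightarrow> coord \<Rightarrow> complex" and t\<^sub>0 :: complex
  assume a6: "a 6 = 1/2 - (a 0 + a 1 + a 2 + a 3 + a 4 + a 5)"
    and sol: "is_solution a U x y z w (\<lambda>t. t)" and p: "\<And>t. p t = point (x t) (y t) (z t) (w t) t a"
    and t: "\<And>t. t \<in> U \<Longrightarrow> t \<noteq> 0 \<and> t - 1 \<noteq> 0" and vp: "\<And>i t. i \<le> 6 \<Longrightarrow> has_value (\<^bold>\<alpha> i) (p t) (a i)"
    and vals: "\<And>t. t \<in> U \<Longrightarrow> has_value ((\<^bold>t * \<^bold>x - 1) / (\<^bold>t - 1)) (p t) (X t)"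
      "\<And>t. t \<in> U \<Longrightarrow> has_value ((\<^bold>t - 1) * \<^bold>y / \<^bold>t) (p t) (Y t)"
      "\<And>t. t \<in> U \<Longrightarrow> has_value ((\<^bold>t * \<^bold>z - 1) / (\<^bold>t - 1)) (p t) (Z t)"
      "\<And>t. t \<in> U \<Longrightarrow> has_value ((\<^bold>t - 1) * \<^bold>w / \<^bold>t) (p t) (W t)"
      "\<And>t. t \<in> U \<Longrightarrow> has_value (1 - \<^bold>t) (p t) (T t)"
    and pars: "has_value (- \<^bold>\<alpha> 0) (p t\<^sub>0) (b 0)" "has_value (\<^bold>\<alpha> 1 + 2 * \<^bold>\<alpha> 0) (p t\<^sub>0) (b 1)"
      "has_value (\<^bold>\<alpha> 2) (p t\<^sub>0) (b 2)" "has_value (\<^bold>\<alpha> 3) (p t\<^sub>0) (b 3)"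
      "has_value (\<^bold>\<alpha> 4) (p t\<^sub>0) (b 4)" "has_value (\<^bold>\<alpha> 5) (p t\<^sub>0) (b 5)"
      "has_value (\<^bold>\<alpha> 6) (p t\<^sub>0) (b 6)"
  have b: "b 0 = - a 0" "b 1 = a 1 + 2 * a 0" "b 2 = a 2" "b 3 = a 3" "b 4 = a 4" "b 5 = a 5"
      "b 6 = a 6"
    by (rule pars[THEN has_value_unique], (intro has_value_arith vp; simp))+
  have eq: "X t = (t * x t - 1) / (t - 1) \<and> Y t = (t - 1) * y t / t \<and>
      Z t = (t * z t - 1) / (t - 1) \<and> W t = (t - 1) * w t / t \<and>
      T t = 1 - t"
    if "t \<in> U" for t
    by (intro conjI vals[OF that, THEN has_value_unique] has_value_arith vp has_value_rvar)
      (use t[OF that] in \<open>simp_all add: p\<close>)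
  show "is_solution b U X Y Z W T"
  proof (rule solution_transform[OF sol eq])
    fix t x' y' z' w'
    assume tU: "t \<in> U" and t01: "t \<noteq> 0" "t - 1 \<noteq> 0"
      and D: "(x has_field_derivative x') (at t)" "(y has_field_derivative y') (at t)"
        "(z has_field_derivative z') (at t)" "(w has_field_derivative w') (at t)"
      and fl: "flow a (x t) (y t) (z t) (w t) t x' y' z' w' 1"
    show "1 - t \<noteq> 0 \<and> 1 - t \<noteq> 1 \<and>
      (\<exists>X' Y' Z' W' T'. T' \<noteq> 0 \<and> ((\<lambda>t. 1 - t) has_field_derivative T') (at t) \<and>
        ((\<lambda>t. (t * x t - 1) / (t - 1)) has_field_derivative X') (at t) \<and>
        ((\<lambda>t. (t - 1) * y t / t) has_field_derivative Y') (at t) \<and>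
        ((\<lambda>t. (t * z t - 1) / (t - 1)) has_field_derivative Z') (at t) \<and>
        ((\<lambda>t. (t - 1) * w t / t) has_field_derivative W') (at t) \<and>
        flow b ((t * x t - 1) / (t - 1)) ((t - 1) * y t / t) ((t * z t - 1) / (t - 1)) ((t - 1) * w
            t / t) (1 - t) X' Y' Z' W' T')"
    proof (intro conjI exI)
      show "flow b ((t * x t - 1) / (t - 1)) ((t - 1) * y t / t) ((t * z t - 1) / (t - 1))
          ((t - 1) * w t / t) (1 - t)
        (((x t + t * x') * (t - 1) - (t * x t - 1)) / (t - 1)\<^sup>2) (y t / t\<^sup>2 + (t - 1) / t * y') (((z t
            + t * z') * (t - 1) - (t * z t - 1)) / (t - 1)\<^sup>2) (w t / t\<^sup>2 + (t - 1) / t * w') (- 1)"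
        by (rule flow_u0[OF a6 b t01 fl])
      show "((\<lambda>t. 1 - t) has_field_derivative - 1) (at t)"
        by (auto intro!: derivative_eq_intros)
      show "((\<lambda>t. (t * x t - 1) / (t - 1)) has_field_derivative ((x t + t * x') * (t - 1) -
          (t * x t - 1)) / (t - 1)\<^sup>2) (at t)"
        using t01  by (auto intro!: derivative_eq_intros D simp: power2_eq_square field_simps)
      show "((\<lambda>t. (t - 1) * y t / t) has_field_derivative y t / t\<^sup>2 + (t - 1) / t * y') (at t)"
        using t01  by (auto intro!: derivative_eq_intros D simp: power2_eq_square field_simps)
      show "((\<lambda>t. (t * z t - 1) / (t - 1)) has_field_derivative ((z t + t * z') * (t - 1) -
          (t * z t - 1)) / (t - 1)\<^sup>2) (at t)"
        using t01  by (auto intro!: derivative_eq_intros D simp: power2_eq_square field_simps)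
      show "((\<lambda>t. (t - 1) * w t / t) has_field_derivative w t / t\<^sup>2 + (t - 1) / t * w') (at t)"
        using t01  by (auto intro!: derivative_eq_intros D simp: power2_eq_square field_simps)
    qed (use t01 in simp_all)
  qed
qed

lemma baecklund_u1: "baecklund (u 1)"
proof (rule baecklundI[OF u.field_hom_axioms u_u images_u1])
  show "{\<^bold>\<alpha> 0 + \<^bold>\<alpha> 1, - \<^bold>\<alpha> 1, \<^bold>\<alpha> 2 + \<^bold>\<alpha> 1, \<^bold>\<alpha> 3, \<^bold>\<alpha> 4, \<^bold>\<alpha> 5} \<subseteq> par_field"
    by (simp add: par_field_intros)
  fix a b :: "nat \<Rightarrow> complex" and U :: "complex set" and x y z w X Y Z W T :: "complex \<Rightarrow> complex"
    and p :: "complex \<Rightarrow> coord \<Rightarrow> complex" and t\<^sub>0 :: complex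
  assume a6: "a 6 = 1/2 - (a 0 + a 1 + a 2 + a 3 + a 4 + a 5)"
    and sol: "is_solution a U x y z w (\<lambda>t. t)" and p: "\<And>t. p t = point (x t) (y t) (z t) (w t) t a"
    and t: "\<And>t. t \<in> U \<Longrightarrow> t \<noteq> 0 \<and> t - 1 \<noteq> 0" and vp: "\<And>i t. i \<le> 6 \<Longrightarrow> has_value (\<^bold>\<alpha> i) (p t) (a i)"
    and vals: "\<And>t. t \<in> U \<Longrightarrow> has_value \<^bold>x (p t) (X t)"
      "\<And>t. t \<in> U \<Longrightarrow> has_value (\<^bold>y - \<^bold>\<alpha> 1 / \<^bold>x) (p t) (Y t)"
      "\<And>t. t \<in> U \<Longrightarrow> has_value \<^bold>z (p t) (Z t)"
      "\<And>t. t \<in> U \<Longrightarrow> has_value \<^bold>w (p t) (W t)"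
      "\<And>t. t \<in> U \<Longrightarrow> has_value \<^bold>t (p t) (T t)"
    and pars: "has_value (\<^bold>\<alpha> 0 + \<^bold>\<alpha> 1) (p t\<^sub>0) (b 0)" "has_value (- \<^bold>\<alpha> 1) (p t\<^sub>0) (b 1)"
      "has_value (\<^bold>\<alpha> 2 + \<^bold>\<alpha> 1) (p t\<^sub>0) (b 2)" "has_value (\<^bold>\<alpha> 3) (p t\<^sub>0) (b 3)"
      "has_value (\<^bold>\<alpha> 4) (p t\<^sub>0) (b 4)" "has_value (\<^bold>\<alpha> 5) (p t\<^sub>0) (b 5)"
      "has_value (\<^bold>\<alpha> 6) (p t\<^sub>0) (b 6)"
  have b: "b 0 = a 0 + a 1" "b 1 = - a 1" "b 2 = a 2 + a 1" "b 3 = a 3" "b 4 = a 4" "b 5 = a 5"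
      "b 6 = a 6"
    by (rule pars[THEN has_value_unique], (intro has_value_arith vp; simp))+
  have nz0: "x t \<noteq> 0" if "t \<in> U" for t
  proof
    assume 0: "x t = 0"
    \<comment> \<open>The factor \<open>- x\<close> has its sign chosen so that the product becomes
      \<open>+ \<alpha> 1\<close> on \<open>x = 0\<close>, the form that the pole criterion asks
      for.\<close>
    show False
    proof (rule has_value_generic_pole[where v = CA1, OF vals(2)[OF that]])
      show "(\<^bold>y - \<^bold>\<alpha> 1 / \<^bold>x) * (- \<^bold>x) = rvar CA1 - \<^bold>y * \<^bold>x"
        using nonzero by (simp add: par_simps field_simps)
      show "has_value (- \<^bold>x) ((p t)(CA1 := b)) 0" for b
        by (rule has_value_eqI, (rule has_value_arith has_value_rvar refl)+) (use 0 in \<open>simp add: p\<close>)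
      show "has_value (rvar CA1 - \<^bold>y * \<^bold>x) ((p t)(CA1 := b)) b" for b
        by (rule has_value_eqI, (rule has_value_arith has_value_rvar refl)+) (use 0 in \<open>simp add: p\<close>)
    qed
  qed
  have eq: "X t = x t \<and> Y t = y t - a 1 / x t \<and> Z t = z t \<and> W t = w t \<and> T t = t"
    if "t \<in> U" for t
    by (intro conjI vals[OF that, THEN has_value_unique] has_value_arith vp has_value_rvar)
      (use t[OF that] nz0[OF that] in \<open>simp_all add: p\<close>)
  show "is_solution b U X Y Z W T"
  proof (rule solution_transform[OF sol eq])
    fix t x' y' z' w'
    assume tU: "t \<in> U" and t01: "t \<noteq> 0" "t - 1 \<noteq> 0"
      and D: "(x has_field_derivative x') (at t)" "(y has_field_derivative y') (at t)"
        "(z has_field_derivative z') (at t)" "(w has_field_derivative w') (at t)"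
      and fl: "flow a (x t) (y t) (z t) (w t) t x' y' z' w' 1"
    show "t \<noteq> 0 \<and> t \<noteq> 1 \<and>
      (\<exists>X' Y' Z' W' T'. T' \<noteq> 0 \<and> ((\<lambda>t. t) has_field_derivative T') (at t) \<and>
        ((\<lambda>t. x t) has_field_derivative X') (at t) \<and>
        ((\<lambda>t. y t - a 1 / x t) has_field_derivative Y') (at t) \<and>
        ((\<lambda>t. z t) has_field_derivative Z') (at t) \<and>
        ((\<lambda>t. w t) has_field_derivative W') (at t) \<and>
        flow b (x t) (y t - a 1 / x t) (z t) (w t) t X' Y' Z' W' T')"
    proof (intro conjI exI)
      show "flow b (x t) (y t - a 1 / x t) (z t) (w t) t
        x' (y' + a 1 * x' / (x t)\<^sup>2) z' w' 1"
        by (rule flow_u1[OF a6 b nz0[OF tU] fl])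
      show "((\<lambda>t. t) has_field_derivative 1) (at t)"
        by (rule DERIV_ident)
      show "((\<lambda>t. x t) has_field_derivative x') (at t)"
        by (rule D)
      show "((\<lambda>t. y t - a 1 / x t) has_field_derivative y' + a 1 * x' / (x t)\<^sup>2) (at t)"
        using t01 nz0[OF tU] by (auto intro!: derivative_eq_intros D simp: power2_eq_square field_simps)
      show "((\<lambda>t. z t) has_field_derivative z') (at t)"
        by (rule D)
      show "((\<lambda>t. w t) has_field_derivative w') (at t)"
        by (rule D)
    qed (use t01 in simp_all)
  qed
qed

lemma baecklund_u2: "baecklund (u 2)"
proof (rule baecklundI[OF u.field_hom_axioms u_u images_u2])
  show "{\<^bold>\<alpha> 0, \<^bold>\<alpha> 1 + \<^bold>\<alpha> 2, - \<^bold>\<alpha> 2, \<^bold>\<alpha> 3 + \<^bold>\<alpha> 2, \<^bold>\<alpha> 4, \<^bold>\<alpha> 5} \<subseteq> par_field"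
    by (simp add: par_field_intros)
  fix a b :: "nat \<Rightarrow> complex" and U :: "complex set" and x y z w X Y Z W T :: "complex \<Rightarrow> complex"
    and p :: "complex \<Rightarrow> coord \<Rightarrow> complex" and t\<^sub>0 :: complex
  assume a6: "a 6 = 1/2 - (a 0 + a 1 + a 2 + a 3 + a 4 + a 5)"
    and sol: "is_solution a U x y z w (\<lambda>t. t)" and p: "\<And>t. p t = point (x t) (y t) (z t) (w t) t a"
    and t: "\<And>t. t \<in> U \<Longrightarrow> t \<noteq> 0 \<and> t - 1 \<noteq> 0" and vp: "\<And>i t. i \<le> 6 \<Longrightarrow> has_value (\<^bold>\<alpha> i) (p t) (a i)"
    and vals: "\<And>t. t \<in> U \<Longrightarrow> has_value (\<^bold>x + \<^bold>\<alpha> 2 / \<^bold>y) (p t) (X t)"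
      "\<And>t. t \<in> U \<Longrightarrow> has_value \<^bold>y (p t) (Y t)"
      "\<And>t. t \<in> U \<Longrightarrow> has_value \<^bold>z (p t) (Z t)"
      "\<And>t. t \<in> U \<Longrightarrow> has_value \<^bold>w (p t) (W t)"
      "\<And>t. t \<in> U \<Longrightarrow> has_value \<^bold>t (p t) (T t)"
    and pars: "has_value (\<^bold>\<alpha> 0) (p t\<^sub>0) (b 0)" "has_value (\<^bold>\<alpha> 1 + \<^bold>\<alpha> 2) (p t\<^sub>0) (b 1)"
      "has_value (- \<^bold>\<alpha> 2) (p t\<^sub>0) (b 2)" "has_value (\<^bold>\<alpha> 3 + \<^bold>\<alpha> 2) (p t\<^sub>0) (b 3)"
      "has_value (\<^bold>\<alpha> 4) (p t\<^sub>0) (b 4)" "has_value (\<^bold>\<alpha> 5) (p t\<^sub>0) (b 5)"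
      "has_value (\<^bold>\<alpha> 6) (p t\<^sub>0) (b 6)"
  have b: "b 0 = a 0" "b 1 = a 1 + a 2" "b 2 = - a 2" "b 3 = a 3 + a 2" "b 4 = a 4" "b 5 = a 5"
      "b 6 = a 6"
    by (rule pars[THEN has_value_unique], (intro has_value_arith vp; simp))+
  have nz0: "y t \<noteq> 0" if "t \<in> U" for t
  proof
    assume 0: "y t = 0"
    show False
    proof (rule has_value_generic_pole[where v = CA2, OF vals(1)[OF that]])
      show "(\<^bold>x + \<^bold>\<alpha> 2 / \<^bold>y) * (\<^bold>y) = \<^bold>x * \<^bold>y + rvar CA2"
        using nonzero by (simp add: par_simps field_simps)
      show "has_value (\<^bold>y) ((p t)(CA2 := b)) 0" for b
        by (rule has_value_eqI, (rule has_value_arith has_value_rvar refl)+) (use 0 in \<open>simp add: p\<close>)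
      show "has_value (\<^bold>x * \<^bold>y + rvar CA2) ((p t)(CA2 := b)) b" for b
        by (rule has_value_eqI, (rule has_value_arith has_value_rvar refl)+) (use 0 in \<open>simp add: p\<close>)
    qed
  qed
  have eq: "X t = x t + a 2 / y t \<and> Y t = y t \<and> Z t = z t \<and> W t = w t \<and> T t = t"
    if "t \<in> U" for t
    by (intro conjI vals[OF that, THEN has_value_unique] has_value_arith vp has_value_rvar)
      (use t[OF that] nz0[OF that] in \<open>simp_all add: p\<close>)
  show "is_solution b U X Y Z W T"
  proof (rule solution_transform[OF sol eq])
    fix t x' y' z' w'
    assume tU: "t \<in> U" and t01: "t \<noteq> 0" "t - 1 \<noteq> 0"
      and D: "(x has_field_derivative x') (at t)" "(y has_field_derivative y') (at t)"
        "(z has_field_derivative z') (at t)" "(w has_field_derivative w') (at t)"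
      and fl: "flow a (x t) (y t) (z t) (w t) t x' y' z' w' 1"
    show "t \<noteq> 0 \<and> t \<noteq> 1 \<and>
      (\<exists>X' Y' Z' W' T'. T' \<noteq> 0 \<and> ((\<lambda>t. t) has_field_derivative T') (at t) \<and>
        ((\<lambda>t. x t + a 2 / y t) has_field_derivative X') (at t) \<and>
        ((\<lambda>t. y t) has_field_derivative Y') (at t) \<and>
        ((\<lambda>t. z t) has_field_derivative Z') (at t) \<and>
        ((\<lambda>t. w t) has_field_derivative W') (at t) \<and>
        flow b (x t + a 2 / y t) (y t) (z t) (w t) t X' Y' Z' W' T')"
    proof (intro conjI exI)
      show "flow b (x t + a 2 / y t) (y t) (z t) (w t) t
        (x' - a 2 * y' / (y t)\<^sup>2) y' z' w' 1"
        by (rule flow_u2[OF a6 b nz0[OF tU] fl])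
      show "((\<lambda>t. t) has_field_derivative 1) (at t)"
        by (rule DERIV_ident)
      show "((\<lambda>t. x t + a 2 / y t) has_field_derivative x' - a 2 * y' / (y t)\<^sup>2) (at t)"
        using t01 nz0[OF tU] by (auto intro!: derivative_eq_intros D simp: power2_eq_square field_simps)
      show "((\<lambda>t. y t) has_field_derivative y') (at t)"
        by (rule D)
      show "((\<lambda>t. z t) has_field_derivative z') (at t)"
        by (rule D)
      show "((\<lambda>t. w t) has_field_derivative w') (at t)"
        by (rule D)
    qed (use t01 in simp_all)
  qed
qed

lemma baecklund_u3: "baecklund (u 3)"
proof (rule baecklundI[OF u.field_hom_axioms u_u images_u3])
  show "{\<^bold>\<alpha> 0, \<^bold>\<alpha> 1, \<^bold>\<alpha> 2 + \<^bold>\<alpha> 3, - \<^bold>\<alpha> 3, \<^bold>\<alpha> 4 + \<^bold>\<alpha> 3, \<^bold>\<alpha> 5} \<subseteq> par_field"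
    by (simp add: par_field_intros)
  fix a b :: "nat \<Rightarrow> complex" and U :: "complex set" and x y z w X Y Z W T :: "complex \<Rightarrow> complex"
    and p :: "complex \<Rightarrow> coord \<Rightarrow> complex" and t\<^sub>0 :: complex
  assume a6: "a 6 = 1/2 - (a 0 + a 1 + a 2 + a 3 + a 4 + a 5)"
    and sol: "is_solution a U x y z w (\<lambda>t. t)" and p: "\<And>t. p t = point (x t) (y t) (z t) (w t) t a"
    and t: "\<And>t. t \<in> U \<Longrightarrow> t \<noteq> 0 \<and> t - 1 \<noteq> 0" and vp: "\<And>i t. i \<le> 6 \<Longrightarrow> has_value (\<^bold>\<alpha> i) (p t) (a i)"
    and vals: "\<And>t. t \<in> U \<Longrightarrow> has_value \<^bold>x (p t) (X t)"
      "\<And>t. t \<in> U \<Longrightarrow> has_value (\<^bold>y - \<^bold>\<alpha> 3 / (\<^bold>x - \<^bold>z)) (p t) (Y t)"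
      "\<And>t. t \<in> U \<Longrightarrow> has_value \<^bold>z (p t) (Z t)"
      "\<And>t. t \<in> U \<Longrightarrow> has_value (\<^bold>w + \<^bold>\<alpha> 3 / (\<^bold>x - \<^bold>z)) (p t) (W t)"
      "\<And>t. t \<in> U \<Longrightarrow> has_value \<^bold>t (p t) (T t)"
    and pars: "has_value (\<^bold>\<alpha> 0) (p t\<^sub>0) (b 0)" "has_value (\<^bold>\<alpha> 1) (p t\<^sub>0) (b 1)"
      "has_value (\<^bold>\<alpha> 2 + \<^bold>\<alpha> 3) (p t\<^sub>0) (b 2)" "has_value (- \<^bold>\<alpha> 3) (p t\<^sub>0) (b 3)"
      "has_value (\<^bold>\<alpha> 4 + \<^bold>\<alpha> 3) (p t\<^sub>0) (b 4)" "has_value (\<^bold>\<alpha> 5) (p t\<^sub>0) (b 5)"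
      "has_value (\<^bold>\<alpha> 6) (p t\<^sub>0) (b 6)"
  have b: "b 0 = a 0" "b 1 = a 1" "b 2 = a 2 + a 3" "b 3 = - a 3" "b 4 = a 4 + a 3" "b 5 = a 5"
      "b 6 = a 6"
    by (rule pars[THEN has_value_unique], (intro has_value_arith vp; simp))+
  have nz0: "x t - z t \<noteq> 0" if "t \<in> U" for t
  proof
    assume 0: "x t - z t = 0"
    \<comment> \<open>The pole is read off from the image of \<open>w\<close>, where
      \<open>\<alpha> 3\<close> has the positive sign, so that multiplication by
      \<open>x - z\<close> leaves \<open>+ \<alpha> 3\<close>.\<close>
    show False
    proof (rule has_value_generic_pole[where v = CA3, OF vals(4)[OF that]])
      show "(\<^bold>w + \<^bold>\<alpha> 3 / (\<^bold>x - \<^bold>z)) * (\<^bold>x - \<^bold>z) = \<^bold>w * (\<^bold>x - \<^bold>z) + rvar CA3"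
        using nonzero by (simp add: par_simps field_simps)
      show "has_value (\<^bold>x - \<^bold>z) ((p t)(CA3 := b)) 0" for b
        by (rule has_value_eqI, (rule has_value_arith has_value_rvar refl)+) (use 0 in \<open>simp add: p\<close>)
      show "has_value (\<^bold>w * (\<^bold>x - \<^bold>z) + rvar CA3) ((p t)(CA3 := b)) b" for b
        by (rule has_value_eqI, (rule has_value_arith has_value_rvar refl)+) (use 0 in \<open>simp add: p\<close>)
    qed
  qed
  have eq: "X t = x t \<and> Y t = y t - a 3 / (x t - z t) \<and>
      Z t = z t \<and> W t = w t + a 3 / (x t - z t) \<and>
      T t = t"
    if "t \<in> U" for t
    by (intro conjI vals[OF that, THEN has_value_unique] has_value_arith vp has_value_rvar)
      (use t[OF that] nz0[OF that] in \<open>simp_all add: p\<close>)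
  show "is_solution b U X Y Z W T"
  proof (rule solution_transform[OF sol eq])
    fix t x' y' z' w'
    assume tU: "t \<in> U" and t01: "t \<noteq> 0" "t - 1 \<noteq> 0"
      and D: "(x has_field_derivative x') (at t)" "(y has_field_derivative y') (at t)"
        "(z has_field_derivative z') (at t)" "(w has_field_derivative w') (at t)"
      and fl: "flow a (x t) (y t) (z t) (w t) t x' y' z' w' 1"
    show "t \<noteq> 0 \<and> t \<noteq> 1 \<and>
      (\<exists>X' Y' Z' W' T'. T' \<noteq> 0 \<and> ((\<lambda>t. t) has_field_derivative T') (at t) \<and>
        ((\<lambda>t. x t) has_field_derivative X') (at t) \<and>
        ((\<lambda>t. y t - a 3 / (x t - z t)) has_field_derivative Y') (at t) \<and>
        ((\<lambda>t. z t) has_field_derivative Z') (at t) \<and>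
        ((\<lambda>t. w t + a 3 / (x t - z t)) has_field_derivative W') (at t) \<and>
        flow b (x t) (y t - a 3 / (x t - z t)) (z t) (w t + a 3 / (x t - z t)) t X' Y' Z' W' T')"
    proof (intro conjI exI)
      show "flow b (x t) (y t - a 3 / (x t - z t)) (z t) (w t + a 3 / (x t - z t)) t
        x' (y' + a 3 * (x' - z') / (x t - z t)\<^sup>2) z' (w' - a 3 * (x' - z') / (x t - z t)\<^sup>2) 1"
        by (rule flow_u3[OF a6 b nz0[OF tU] fl])
      show "((\<lambda>t. t) has_field_derivative 1) (at t)"
        by (rule DERIV_ident)
      show "((\<lambda>t. x t) has_field_derivative x') (at t)"
        by (rule D)
      show "((\<lambda>t. y t - a 3 / (x t - z t)) has_field_derivative y' + a 3 * (x' - z') / (x t - z t)\<^sup>2)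
          (at t)"
        by (rule DERIV_cong[OF DERIV_diff[OF D(2) DERIV_divide[OF DERIV_const DERIV_diff[OF D(1,3)]
            nz0[OF tU]]]])
          (simp add: power2_eq_square)
      show "((\<lambda>t. z t) has_field_derivative z') (at t)"
        by (rule D)
      show "((\<lambda>t. w t + a 3 / (x t - z t)) has_field_derivative w' - a 3 * (x' - z') / (x t - z t)\<^sup>2)
          (at t)"
        by (rule DERIV_cong[OF DERIV_add[OF D(4) DERIV_divide[OF DERIV_const DERIV_diff[OF D(1,3)]
            nz0[OF tU]]]])
          (simp add: power2_eq_square)
    qed (use t01 in simp_all)
  qed
qed

lemma baecklund_u4: "baecklund (u 4)"
proof (rule baecklundI[OF u.field_hom_axioms u_u images_u4])
  show "{\<^bold>\<alpha> 0, \<^bold>\<alpha> 1, \<^bold>\<alpha> 2, \<^bold>\<alpha> 3 + \<^bold>\<alpha> 4, - \<^bold>\<alpha> 4, \<^bold>\<alpha> 5 + \<^bold>\<alpha> 4} \<subseteq> par_field"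
    by (simp add: par_field_intros)
  fix a b :: "nat \<Rightarrow> complex" and U :: "complex set" and x y z w X Y Z W T :: "complex \<Rightarrow> complex"
    and p :: "complex \<Rightarrow> coord \<Rightarrow> complex" and t\<^sub>0 :: complex
  assume a6: "a 6 = 1/2 - (a 0 + a 1 + a 2 + a 3 + a 4 + a 5)"
    and sol: "is_solution a U x y z w (\<lambda>t. t)" and p: "\<And>t. p t = point (x t) (y t) (z t) (w t) t a"
    and t: "\<And>t. t \<in> U \<Longrightarrow> t \<noteq> 0 \<and> t - 1 \<noteq> 0" and vp: "\<And>i t. i \<le> 6 \<Longrightarrow> has_value (\<^bold>\<alpha> i) (p t) (a i)"
    and vals: "\<And>t. t \<in> U \<Longrightarrow> has_value \<^bold>x (p t) (X t)"
      "\<And>t. t \<in> U \<Longrightarrow> has_value \<^bold>y (p t) (Y t)"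
      "\<And>t. t \<in> U \<Longrightarrow> has_value (\<^bold>z + \<^bold>\<alpha> 4 / \<^bold>w) (p t) (Z t)"
      "\<And>t. t \<in> U \<Longrightarrow> has_value \<^bold>w (p t) (W t)"
      "\<And>t. t \<in> U \<Longrightarrow> has_value \<^bold>t (p t) (T t)"
    and pars: "has_value (\<^bold>\<alpha> 0) (p t\<^sub>0) (b 0)" "has_value (\<^bold>\<alpha> 1) (p t\<^sub>0) (b 1)"
      "has_value (\<^bold>\<alpha> 2) (p t\<^sub>0) (b 2)" "has_value (\<^bold>\<alpha> 3 + \<^bold>\<alpha> 4) (p t\<^sub>0) (b 3)"
      "has_value (- \<^bold>\<alpha> 4) (p t\<^sub>0) (b 4)" "has_value (\<^bold>\<alpha> 5 + \<^bold>\<alpha> 4) (p t\<^sub>0) (b 5)"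
      "has_value (\<^bold>\<alpha> 6) (p t\<^sub>0) (b 6)"
  have b: "b 0 = a 0" "b 1 = a 1" "b 2 = a 2" "b 3 = a 3 + a 4" "b 4 = - a 4" "b 5 = a 5 + a 4"
      "b 6 = a 6"
    by (rule pars[THEN has_value_unique], (intro has_value_arith vp; simp))+
  have nz0: "w t \<noteq> 0" if "t \<in> U" for t
  proof
    assume 0: "w t = 0"
    show False
    proof (rule has_value_generic_pole[where v = CA4, OF vals(3)[OF that]])
      show "(\<^bold>z + \<^bold>\<alpha> 4 / \<^bold>w) * (\<^bold>w) = \<^bold>z * \<^bold>w + rvar CA4"
        using nonzero by (simp add: par_simps field_simps)
      show "has_value (\<^bold>w) ((p t)(CA4 := b)) 0" for b
        by (rule has_value_eqI, (rule has_value_arith has_value_rvar refl)+) (use 0 in \<open>simp add: p\<close>)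
      show "has_value (\<^bold>z * \<^bold>w + rvar CA4) ((p t)(CA4 := b)) b" for b
        by (rule has_value_eqI, (rule has_value_arith has_value_rvar refl)+) (use 0 in \<open>simp add: p\<close>)
    qed
  qed
  have eq: "X t = x t \<and> Y t = y t \<and> Z t = z t + a 4 / w t \<and> W t = w t \<and> T t = t"
    if "t \<in> U" for t
    by (intro conjI vals[OF that, THEN has_value_unique] has_value_arith vp has_value_rvar)
      (use t[OF that] nz0[OF that] in \<open>simp_all add: p\<close>)
  show "is_solution b U X Y Z W T"
  proof (rule solution_transform[OF sol eq])
    fix t x' y' z' w'
    assume tU: "t \<in> U" and t01: "t \<noteq> 0" "t - 1 \<noteq> 0"
      and D: "(x has_field_derivative x') (at t)" "(y has_field_derivative y') (at t)"
        "(z has_field_derivative z') (at t)" "(w has_field_derivative w') (at t)"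
      and fl: "flow a (x t) (y t) (z t) (w t) t x' y' z' w' 1"
    show "t \<noteq> 0 \<and> t \<noteq> 1 \<and>
      (\<exists>X' Y' Z' W' T'. T' \<noteq> 0 \<and> ((\<lambda>t. t) has_field_derivative T') (at t) \<and>
        ((\<lambda>t. x t) has_field_derivative X') (at t) \<and>
        ((\<lambda>t. y t) has_field_derivative Y') (at t) \<and>
        ((\<lambda>t. z t + a 4 / w t) has_field_derivative Z') (at t) \<and>
        ((\<lambda>t. w t) has_field_derivative W') (at t) \<and>
        flow b (x t) (y t) (z t + a 4 / w t) (w t) t X' Y' Z' W' T')"
    proof (intro conjI exI)
      show "flow b (x t) (y t) (z t + a 4 / w t) (w t) t
        x' y' (z' - a 4 * w' / (w t)\<^sup>2) w' 1"
        by (rule flow_u4[OF a6 b nz0[OF tU] fl])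
      show "((\<lambda>t. t) has_field_derivative 1) (at t)"
        by (rule DERIV_ident)
      show "((\<lambda>t. x t) has_field_derivative x') (at t)"
        by (rule D)
      show "((\<lambda>t. y t) has_field_derivative y') (at t)"
        by (rule D)
      show "((\<lambda>t. z t + a 4 / w t) has_field_derivative z' - a 4 * w' / (w t)\<^sup>2) (at t)"
        using t01 nz0[OF tU] by (auto intro!: derivative_eq_intros D simp: power2_eq_square field_simps)
      show "((\<lambda>t. w t) has_field_derivative w') (at t)"
        by (rule D)
    qed (use t01 in simp_all)
  qed
qed

lemma baecklund_u5: "baecklund (u 5)"
proof (rule baecklundI[OF u.field_hom_axioms u_u images_u5])
  show "{\<^bold>\<alpha> 0, \<^bold>\<alpha> 1, \<^bold>\<alpha> 2, \<^bold>\<alpha> 3, \<^bold>\<alpha> 4 + \<^bold>\<alpha> 5, - \<^bold>\<alpha> 5} \<subseteq> par_field"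
    by (simp add: par_field_intros)
  fix a b :: "nat \<Rightarrow> complex" and U :: "complex set" and x y z w X Y Z W T :: "complex \<Rightarrow> complex"
    and p :: "complex \<Rightarrow> coord \<Rightarrow> complex" and t\<^sub>0 :: complex
  assume a6: "a 6 = 1/2 - (a 0 + a 1 + a 2 + a 3 + a 4 + a 5)"
    and sol: "is_solution a U x y z w (\<lambda>t. t)" and p: "\<And>t. p t = point (x t) (y t) (z t) (w t) t a"
    and t: "\<And>t. t \<in> U \<Longrightarrow> t \<noteq> 0 \<and> t - 1 \<noteq> 0" and vp: "\<And>i t. i \<le> 6 \<Longrightarrow> has_value (\<^bold>\<alpha> i) (p t) (a i)"
    and vals: "\<And>t. t \<in> U \<Longrightarrow> has_value \<^bold>x (p t) (X t)"
      "\<And>t. t \<in> U \<Longrightarrow> has_value \<^bold>y (p t) (Y t)"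
      "\<And>t. t \<in> U \<Longrightarrow> has_value \<^bold>z (p t) (Z t)"
      "\<And>t. t \<in> U \<Longrightarrow> has_value \<^bold>w (p t) (W t)"
      "\<And>t. t \<in> U \<Longrightarrow> has_value \<^bold>t (p t) (T t)"
    and pars: "has_value (\<^bold>\<alpha> 0) (p t\<^sub>0) (b 0)" "has_value (\<^bold>\<alpha> 1) (p t\<^sub>0) (b 1)"
      "has_value (\<^bold>\<alpha> 2) (p t\<^sub>0) (b 2)" "has_value (\<^bold>\<alpha> 3) (p t\<^sub>0) (b 3)"
      "has_value (\<^bold>\<alpha> 4 + \<^bold>\<alpha> 5) (p t\<^sub>0) (b 4)" "has_value (- \<^bold>\<alpha> 5) (p t\<^sub>0) (b 5)"
      "has_value (\<^bold>\<alpha> 6 + \<^bold>\<alpha> 5) (p t\<^sub>0) (b 6)"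
  have b: "b 0 = a 0" "b 1 = a 1" "b 2 = a 2" "b 3 = a 3" "b 4 = a 4 + a 5" "b 5 = - a 5"
      "b 6 = a 6 + a 5"
    by (rule pars[THEN has_value_unique], (intro has_value_arith vp; simp))+
  have eq: "X t = x t \<and> Y t = y t \<and> Z t = z t \<and> W t = w t \<and> T t = t"
    if "t \<in> U" for t
    by (intro conjI vals[OF that, THEN has_value_unique] has_value_arith vp has_value_rvar)
      (use t[OF that] in \<open>simp_all add: p\<close>)
  show "is_solution b U X Y Z W T"
  proof (rule solution_transform[OF sol eq])
    fix t x' y' z' w'
    assume tU: "t \<in> U" and t01: "t \<noteq> 0" "t - 1 \<noteq> 0"
      and D: "(x has_field_derivative x') (at t)" "(y has_field_derivative y') (at t)"
        "(z has_field_derivative z') (at t)" "(w has_field_derivative w') (at t)"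
      and fl: "flow a (x t) (y t) (z t) (w t) t x' y' z' w' 1"
    show "t \<noteq> 0 \<and> t \<noteq> 1 \<and>
      (\<exists>X' Y' Z' W' T'. T' \<noteq> 0 \<and> ((\<lambda>t. t) has_field_derivative T') (at t) \<and>
        ((\<lambda>t. x t) has_field_derivative X') (at t) \<and>
        ((\<lambda>t. y t) has_field_derivative Y') (at t) \<and>
        ((\<lambda>t. z t) has_field_derivative Z') (at t) \<and>
        ((\<lambda>t. w t) has_field_derivative W') (at t) \<and>
        flow b (x t) (y t) (z t) (w t) t X' Y' Z' W' T')"
    proof (intro conjI exI)
      show "flow b (x t) (y t) (z t) (w t) t
        x' y' z' w' 1"
        by (rule flow_u5[OF a6 b  fl])
      show "((\<lambda>t. t) has_field_derivative 1) (at t)"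
        by (rule DERIV_ident)
      show "((\<lambda>t. x t) has_field_derivative x') (at t)"
        by (rule D)
      show "((\<lambda>t. y t) has_field_derivative y') (at t)"
        by (rule D)
      show "((\<lambda>t. z t) has_field_derivative z') (at t)"
        by (rule D)
      show "((\<lambda>t. w t) has_field_derivative w') (at t)"
        by (rule D)
    qed (use t01 in simp_all)
  qed
qed

lemma baecklund_u6: "baecklund (u 6)"
proof (rule baecklundI[OF u.field_hom_axioms u_u images_u6])
  show "{\<^bold>\<alpha> 0, \<^bold>\<alpha> 1, \<^bold>\<alpha> 2, \<^bold>\<alpha> 3, \<^bold>\<alpha> 4, \<^bold>\<alpha> 5 + 2 * \<^bold>\<alpha> 6} \<subseteq> par_field"
    by (simp add: par_field_intros)
  fix a b :: "nat \<Rightarrow> complex" and U :: "complex set" and x y z w X Y Z W T :: "complex \<Rightarrow> complex"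
    and p :: "complex \<Rightarrow> coord \<Rightarrow> complex" and t\<^sub>0 :: complex
  assume a6: "a 6 = 1/2 - (a 0 + a 1 + a 2 + a 3 + a 4 + a 5)"
    and sol: "is_solution a U x y z w (\<lambda>t. t)" and p: "\<And>t. p t = point (x t) (y t) (z t) (w t) t a"
    and t: "\<And>t. t \<in> U \<Longrightarrow> t \<noteq> 0 \<and> t - 1 \<noteq> 0" and vp: "\<And>i t. i \<le> 6 \<Longrightarrow> has_value (\<^bold>\<alpha> i) (p t) (a i)"
    and vals: "\<And>t. t \<in> U \<Longrightarrow> has_value (\<^bold>x / (\<^bold>x - 1)) (p t) (X t)"
      "\<And>t. t \<in> U \<Longrightarrow> has_value (- (\<^bold>x - 1) * ((\<^bold>x - 1) * \<^bold>y + \<^bold>\<alpha> 2)) (p t) (Y t)"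
      "\<And>t. t \<in> U \<Longrightarrow> has_value (\<^bold>z / (\<^bold>z - 1)) (p t) (Z t)"
      "\<And>t. t \<in> U \<Longrightarrow> has_value (- (\<^bold>z - 1) * ((\<^bold>z - 1) * \<^bold>w + \<^bold>\<alpha> 4)) (p t) (W t)"
      "\<And>t. t \<in> U \<Longrightarrow> has_value (1 - \<^bold>t) (p t) (T t)"
    and pars: "has_value (\<^bold>\<alpha> 0) (p t\<^sub>0) (b 0)" "has_value (\<^bold>\<alpha> 1) (p t\<^sub>0) (b 1)"
      "has_value (\<^bold>\<alpha> 2) (p t\<^sub>0) (b 2)" "has_value (\<^bold>\<alpha> 3) (p t\<^sub>0) (b 3)"
      "has_value (\<^bold>\<alpha> 4) (p t\<^sub>0) (b 4)" "has_value (\<^bold>\<alpha> 5 + 2 * \<^bold>\<alpha> 6) (p t\<^sub>0) (b 5)"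
      "has_value (- \<^bold>\<alpha> 6) (p t\<^sub>0) (b 6)"
  have b: "b 0 = a 0" "b 1 = a 1" "b 2 = a 2" "b 3 = a 3" "b 4 = a 4" "b 5 = a 5 + 2 * a 6"
      "b 6 = - a 6"
    by (rule pars[THEN has_value_unique], (intro has_value_arith vp; simp))+
  have nz0: "x t - 1 \<noteq> 0" if "t \<in> U" for t
  proof
    assume 0: "x t - 1 = 0"
    \<comment> \<open>At \<open>x = 1\<close> the numerator \<open>x\<close> has the value 1, so
      this pole is present at every parameter value and no perturbation enters.\<close>
    show False
    proof (rule has_value_pole[OF vals(1)[OF that]])
      show "(\<^bold>x / (\<^bold>x - 1)) * (\<^bold>x - 1) = \<^bold>x"
        using nonzero by (simp add: par_simps field_simps)
      show "has_value (\<^bold>x - 1) (p t) 0"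
        by (rule has_value_eqI, (rule has_value_arith has_value_rvar refl)+) (use 0 in \<open>simp add: p\<close>)
      show "has_value (\<^bold>x) (p t) 1"
        by (rule has_value_eqI, (rule has_value_arith has_value_rvar refl)+) (use 0 in \<open>simp add: p\<close>)
    qed simp
  qed
  have nz1: "z t - 1 \<noteq> 0" if "t \<in> U" for t
  proof
    assume 0: "z t - 1 = 0"
    show False
    proof (rule has_value_pole[OF vals(3)[OF that]])
      show "(\<^bold>z / (\<^bold>z - 1)) * (\<^bold>z - 1) = \<^bold>z"
        using nonzero by (simp add: par_simps field_simps)
      show "has_value (\<^bold>z - 1) (p t) 0"
        by (rule has_value_eqI, (rule has_value_arith has_value_rvar refl)+) (use 0 in \<open>simp add: p\<close>)
      show "has_value (\<^bold>z) (p t) 1"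
        by (rule has_value_eqI, (rule has_value_arith has_value_rvar refl)+) (use 0 in \<open>simp add: p\<close>)
    qed simp
  qed
  have eq: "X t = x t / (x t - 1) \<and> Y t = - (x t - 1) * ((x t - 1) * y t + a 2) \<and>
      Z t = z t / (z t - 1) \<and> W t = - (z t - 1) * ((z t - 1) * w t + a 4) \<and>
      T t = 1 - t"
    if "t \<in> U" for t
    by (intro conjI vals[OF that, THEN has_value_unique] has_value_arith vp has_value_rvar)
      (use t[OF that] nz0[OF that] nz1[OF that] in \<open>simp_all add: p\<close>)
  show "is_solution b U X Y Z W T"
  proof (rule solution_transform[OF sol eq])
    fix t x' y' z' w'
    assume tU: "t \<in> U" and t01: "t \<noteq> 0" "t - 1 \<noteq> 0"
      and D: "(x has_field_derivative x') (at t)" "(y has_field_derivative y') (at t)"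
        "(z has_field_derivative z') (at t)" "(w has_field_derivative w') (at t)"
      and fl: "flow a (x t) (y t) (z t) (w t) t x' y' z' w' 1"
    show "1 - t \<noteq> 0 \<and> 1 - t \<noteq> 1 \<and>
      (\<exists>X' Y' Z' W' T'. T' \<noteq> 0 \<and> ((\<lambda>t. 1 - t) has_field_derivative T') (at t) \<and>
        ((\<lambda>t. x t / (x t - 1)) has_field_derivative X') (at t) \<and>
        ((\<lambda>t. - (x t - 1) * ((x t - 1) * y t + a 2)) has_field_derivative Y') (at t) \<and>
        ((\<lambda>t. z t / (z t - 1)) has_field_derivative Z') (at t) \<and>
        ((\<lambda>t. - (z t - 1) * ((z t - 1) * w t + a 4)) has_field_derivative W') (at t) \<and>
        flow b (x t / (x t - 1)) (- (x t - 1) * ((x t - 1) * y t + a 2)) (z t / (z t - 1)) (- (z t -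
            1) * ((z t - 1) * w t + a 4)) (1 - t) X' Y' Z' W' T')"
    proof (intro conjI exI)
      show "flow b (x t / (x t - 1)) (- (x t - 1) * ((x t - 1) * y t + a 2)) (z t / (z t - 1)) (-
          (z t - 1) * ((z t - 1) * w t + a 4)) (1 - t)
        (- x' / (x t - 1)\<^sup>2) (- (x' * ((x t - 1) * y t + a 2) + (x t - 1) * (x' * y t + (x t - 1) *
            y'))) (- z' / (z t - 1)\<^sup>2) (- (z' * ((z t - 1) * w t + a 4) + (z t - 1) * (z' * w t + (z
            t - 1) * w'))) (- 1)"
        by (rule flow_u6[OF a6 b nz0[OF tU] nz1[OF tU] fl])
      show "((\<lambda>t. 1 - t) has_field_derivative - 1) (at t)"
        by (auto intro!: derivative_eq_intros)
      show "((\<lambda>t. x t / (x t - 1)) has_field_derivative - x' / (x t - 1)\<^sup>2) (at t)"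
        using t01 nz0[OF tU] nz1[OF tU]
            by (auto intro!: derivative_eq_intros D simp: power2_eq_square field_simps)
      show "((\<lambda>t. - (x t - 1) * ((x t - 1) * y t + a 2)) has_field_derivative - (x' * ((x t - 1) * y
          t + a 2) + (x t - 1) * (x' * y t + (x t - 1) * y'))) (at t)"
        using t01 nz0[OF tU] nz1[OF tU]
            by (auto intro!: derivative_eq_intros D simp: power2_eq_square field_simps)
      show "((\<lambda>t. z t / (z t - 1)) has_field_derivative - z' / (z t - 1)\<^sup>2) (at t)"
        using t01 nz0[OF tU] nz1[OF tU]
            by (auto intro!: derivative_eq_intros D simp: power2_eq_square field_simps)
      show "((\<lambda>t. - (z t - 1) * ((z t - 1) * w t + a 4)) has_field_derivative - (z' * ((z t - 1) * w
          t + a 4) + (z t - 1) * (z' * w t + (z t - 1) * w'))) (at t)"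
        using t01 nz0[OF tU] nz1[OF tU]
            by (auto intro!: derivative_eq_intros D simp: power2_eq_square field_simps)
    qed (use t01 in simp_all)
  qed
qed

lemma baecklund_\<phi>: "baecklund \<phi>"
proof (rule baecklundI[OF \<phi>.field_hom_axioms \<phi>_\<phi> images_\<phi>])
  show "{\<^bold>\<alpha> 6, \<^bold>\<alpha> 5, \<^bold>\<alpha> 4, \<^bold>\<alpha> 3, \<^bold>\<alpha> 2, \<^bold>\<alpha> 1} \<subseteq> par_field"
    by (simp add: par_field_intros)
  fix a b :: "nat \<Rightarrow> complex" and U :: "complex set" and x y z w X Y Z W T :: "complex \<Rightarrow> complex"
    and p :: "complex \<Rightarrow> coord \<Rightarrow> complex" and t\<^sub>0 :: complex
  assume a6: "a 6 = 1/2 - (a 0 + a 1 + a 2 + a 3 + a 4 + a 5)"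
    and sol: "is_solution a U x y z w (\<lambda>t. t)" and p: "\<And>t. p t = point (x t) (y t) (z t) (w t) t a"
    and t: "\<And>t. t \<in> U \<Longrightarrow> t \<noteq> 0 \<and> t - 1 \<noteq> 0" and vp: "\<And>i t. i \<le> 6 \<Longrightarrow> has_value (\<^bold>\<alpha> i) (p t) (a i)"
    and vals: "\<And>t. t \<in> U \<Longrightarrow> has_value (1 / (\<^bold>t * \<^bold>z)) (p t) (X t)"
      "\<And>t. t \<in> U \<Longrightarrow> has_value (- \<^bold>t * \<^bold>z * (\<^bold>z * \<^bold>w + \<^bold>\<alpha> 4)) (p t) (Y t)"
      "\<And>t. t \<in> U \<Longrightarrow> has_value (1 / (\<^bold>t * \<^bold>x)) (p t) (Z t)"
      "\<And>t. t \<in> U \<Longrightarrow> has_value (- \<^bold>t * \<^bold>x * (\<^bold>x * \<^bold>y + \<^bold>\<alpha> 2)) (p t) (W t)"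
      "\<And>t. t \<in> U \<Longrightarrow> has_value \<^bold>t (p t) (T t)"
    and pars: "has_value (\<^bold>\<alpha> 6) (p t\<^sub>0) (b 0)" "has_value (\<^bold>\<alpha> 5) (p t\<^sub>0) (b 1)"
      "has_value (\<^bold>\<alpha> 4) (p t\<^sub>0) (b 2)" "has_value (\<^bold>\<alpha> 3) (p t\<^sub>0) (b 3)"
      "has_value (\<^bold>\<alpha> 2) (p t\<^sub>0) (b 4)" "has_value (\<^bold>\<alpha> 1) (p t\<^sub>0) (b 5)"
      "has_value (\<^bold>\<alpha> 0) (p t\<^sub>0) (b 6)"
  have b: "b 0 = a 6" "b 1 = a 5" "b 2 = a 4" "b 3 = a 3" "b 4 = a 2" "b 5 = a 1" "b 6 = a 0"
    by (rule pars[THEN has_value_unique], (intro has_value_arith vp; simp))+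
  have nz0: "x t \<noteq> 0" if "t \<in> U" for t
  proof
    assume 0: "x t = 0"
    \<comment> \<open>Zeros of \<open>x\<close> are poles of the image of \<open>z\<close>, and
      zeros of \<open>z\<close> are poles of the image of \<open>x\<close>; with numerator 1 these
      poles do not depend on the parameters.\<close>
    show False
    proof (rule has_value_pole[OF vals(3)[OF that]])
      show "(1 / (\<^bold>t * \<^bold>x)) * (\<^bold>t * \<^bold>x) = 1"
        using nonzero by (simp add: par_simps field_simps)
      show "has_value (\<^bold>t * \<^bold>x) (p t) 0"
        by (rule has_value_eqI, (rule has_value_arith has_value_rvar refl)+) (use 0 in \<open>simp add: p\<close>)
      show "has_value (1) (p t) 1"
        by (rule has_value_arith)
    qed simp
  qed
  have nz1: "z t \<noteq> 0" if "t \<in> U" for t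
  proof
    assume 0: "z t = 0"
    show False
    proof (rule has_value_pole[OF vals(1)[OF that]])
      show "(1 / (\<^bold>t * \<^bold>z)) * (\<^bold>t * \<^bold>z) = 1"
        using nonzero by (simp add: par_simps field_simps)
      show "has_value (\<^bold>t * \<^bold>z) (p t) 0"
        by (rule has_value_eqI, (rule has_value_arith has_value_rvar refl)+) (use 0 in \<open>simp add: p\<close>)
      show "has_value (1) (p t) 1"
        by (rule has_value_arith)
    qed simp
  qed
  have eq: "X t = 1 / (t * z t) \<and> Y t = - t * z t * (z t * w t + a 4) \<and>
      Z t = 1 / (t * x t) \<and> W t = - t * x t * (x t * y t + a 2) \<and>
      T t = t"
    if "t \<in> U" for t
    by (intro conjI vals[OF that, THEN has_value_unique] has_value_arith vp has_value_rvar)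
      (use t[OF that] nz0[OF that] nz1[OF that] in \<open>simp_all add: p\<close>)
  show "is_solution b U X Y Z W T"
  proof (rule solution_transform[OF sol eq])
    fix t x' y' z' w'
    assume tU: "t \<in> U" and t01: "t \<noteq> 0" "t - 1 \<noteq> 0"
      and D: "(x has_field_derivative x') (at t)" "(y has_field_derivative y') (at t)"
        "(z has_field_derivative z') (at t)" "(w has_field_derivative w') (at t)"
      and fl: "flow a (x t) (y t) (z t) (w t) t x' y' z' w' 1"
    show "t \<noteq> 0 \<and> t \<noteq> 1 \<and>
      (\<exists>X' Y' Z' W' T'. T' \<noteq> 0 \<and> ((\<lambda>t. t) has_field_derivative T') (at t) \<and>
        ((\<lambda>t. 1 / (t * z t)) has_field_derivative X') (at t) \<and>
        ((\<lambda>t. - t * z t * (z t * w t + a 4)) has_field_derivative Y') (at t) \<and>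
        ((\<lambda>t. 1 / (t * x t)) has_field_derivative Z') (at t) \<and>
        ((\<lambda>t. - t * x t * (x t * y t + a 2)) has_field_derivative W') (at t) \<and>
        flow b (1 / (t * z t)) (- t * z t * (z t * w t + a 4)) (1 / (t * x t)) (- t * x t * (x t * y
            t + a 2)) t X' Y' Z' W' T')"
    proof (intro conjI exI)
      show "flow b (1 / (t * z t)) (- t * z t * (z t * w t + a 4)) (1 / (t * x t)) (- t * x t *
          (x t * y t + a 2)) t
        (- (z t + t * z') / (t * z t)\<^sup>2) (- ((z t + t * z') * (z t * w t + a 4) + t * z t * (z' * w t
            + z t * w'))) (- (x t + t * x') / (t * x t)\<^sup>2) (- ((x t + t * x') * (x t * y t + a 2) + t
            * x t * (x' * y t + x t * y'))) 1"
        by (rule flow_\<phi>[OF a6 b nz0[OF tU] nz1[OF tU] t01(1) fl])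
      show "((\<lambda>t. t) has_field_derivative 1) (at t)"
        by (rule DERIV_ident)
      show "((\<lambda>t. 1 / (t * z t)) has_field_derivative - (z t + t * z') / (t * z t)\<^sup>2) (at t)"
        using t01 nz0[OF tU] nz1[OF tU]
            by (auto intro!: derivative_eq_intros D simp: power2_eq_square field_simps)
      show "((\<lambda>t. - t * z t * (z t * w t + a 4)) has_field_derivative - ((z t + t * z') * (z t * w t
          + a 4) + t * z t * (z' * w t + z t * w'))) (at t)"
        using t01 nz0[OF tU] nz1[OF tU]
            by (auto intro!: derivative_eq_intros D simp: power2_eq_square field_simps)
      show "((\<lambda>t. 1 / (t * x t)) has_field_derivative - (x t + t * x') / (t * x t)\<^sup>2) (at t)"
        using t01 nz0[OF tU] nz1[OF tU]
            by (auto intro!: derivative_eq_intros D simp: power2_eq_square field_simps)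
      show "((\<lambda>t. - t * x t * (x t * y t + a 2)) has_field_derivative - ((x t + t * x') * (x t * y t
          + a 2) + t * x t * (x' * y t + x t * y'))) (at t)"
        using t01 nz0[OF tU] nz1[OF tU]
            by (auto intro!: derivative_eq_intros D simp: power2_eq_square field_simps)
    qed (use t01 in simp_all)
  qed
qed

theorem theorem4p1:
  shows "\<exists>(u :: nat \<Rightarrow> ratfun \<Rightarrow> ratfun) (\<phi> :: ratfun \<Rightarrow> ratfun).
    images (u 0) =
      ((\<^bold>t * \<^bold>x - 1) / (\<^bold>t - 1), (\<^bold>t - 1) * \<^bold>y / \<^bold>t, (\<^bold>t * \<^bold>z - 1) / (\<^bold>t - 1), (\<^bold>t - 1) * \<^bold>w / \<^bold>t, 1 - \<^bold>t,
       [- \<^bold>\<alpha> 0, \<^bold>\<alpha> 1 + 2 * \<^bold>\<alpha> 0, \<^bold>\<alpha> 2, \<^bold>\<alpha> 3, \<^bold>\<alpha> 4, \<^bold>\<alpha> 5, \<^bold>\<alpha> 6]) \<and>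
    images (u 1) =
      (\<^bold>x, \<^bold>y - \<^bold>\<alpha> 1 / \<^bold>x, \<^bold>z, \<^bold>w, \<^bold>t,
       [\<^bold>\<alpha> 0 + \<^bold>\<alpha> 1, - \<^bold>\<alpha> 1, \<^bold>\<alpha> 2 + \<^bold>\<alpha> 1, \<^bold>\<alpha> 3, \<^bold>\<alpha> 4, \<^bold>\<alpha> 5, \<^bold>\<alpha> 6]) \<and>
    images (u 2) =
      (\<^bold>x + \<^bold>\<alpha> 2 / \<^bold>y, \<^bold>y, \<^bold>z, \<^bold>w, \<^bold>t,
       [\<^bold>\<alpha> 0, \<^bold>\<alpha> 1 + \<^bold>\<alpha> 2, - \<^bold>\<alpha> 2, \<^bold>\<alpha> 3 + \<^bold>\<alpha> 2, \<^bold>\<alpha> 4, \<^bold>\<alpha> 5, \<^bold>\<alpha> 6]) \<and>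
    images (u 3) =
      (\<^bold>x, \<^bold>y - \<^bold>\<alpha> 3 / (\<^bold>x - \<^bold>z), \<^bold>z, \<^bold>w + \<^bold>\<alpha> 3 / (\<^bold>x - \<^bold>z), \<^bold>t,
       [\<^bold>\<alpha> 0, \<^bold>\<alpha> 1, \<^bold>\<alpha> 2 + \<^bold>\<alpha> 3, - \<^bold>\<alpha> 3, \<^bold>\<alpha> 4 + \<^bold>\<alpha> 3, \<^bold>\<alpha> 5, \<^bold>\<alpha> 6]) \<and>
    images (u 4) =
      (\<^bold>x, \<^bold>y, \<^bold>z + \<^bold>\<alpha> 4 / \<^bold>w, \<^bold>w, \<^bold>t,
       [\<^bold>\<alpha> 0, \<^bold>\<alpha> 1, \<^bold>\<alpha> 2, \<^bold>\<alpha> 3 + \<^bold>\<alpha> 4, - \<^bold>\<alpha> 4, \<^bold>\<alpha> 5 + \<^bold>\<alpha> 4, \<^bold>\<alpha> 6]) \<and>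
    images (u 5) =
      (\<^bold>x, \<^bold>y, \<^bold>z, \<^bold>w, \<^bold>t,
       [\<^bold>\<alpha> 0, \<^bold>\<alpha> 1, \<^bold>\<alpha> 2, \<^bold>\<alpha> 3, \<^bold>\<alpha> 4 + \<^bold>\<alpha> 5, - \<^bold>\<alpha> 5, \<^bold>\<alpha> 6 + \<^bold>\<alpha> 5]) \<and>
    images (u 6) =
      (\<^bold>x / (\<^bold>x - 1), - (\<^bold>x - 1) * ((\<^bold>x - 1) * \<^bold>y + \<^bold>\<alpha> 2),
       \<^bold>z / (\<^bold>z - 1), - (\<^bold>z - 1) * ((\<^bold>z - 1) * \<^bold>w + \<^bold>\<alpha> 4), 1 - \<^bold>t,
       [\<^bold>\<alpha> 0, \<^bold>\<alpha> 1, \<^bold>\<alpha> 2, \<^bold>\<alpha> 3, \<^bold>\<alpha> 4, \<^bold>\<alpha> 5 + 2 * \<^bold>\<alpha> 6, - \<^bold>\<alpha> 6]) \<and>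
    images \<phi> =
      (1 / (\<^bold>t * \<^bold>z), - \<^bold>t * \<^bold>z * (\<^bold>z * \<^bold>w + \<^bold>\<alpha> 4),
       1 / (\<^bold>t * \<^bold>x), - \<^bold>t * \<^bold>x * (\<^bold>x * \<^bold>y + \<^bold>\<alpha> 2), \<^bold>t,
       [\<^bold>\<alpha> 6, \<^bold>\<alpha> 5, \<^bold>\<alpha> 4, \<^bold>\<alpha> 3, \<^bold>\<alpha> 2, \<^bold>\<alpha> 1, \<^bold>\<alpha> 0]) \<and>
    (\<forall>i\<le>6. baecklund (u i)) \<and> baecklund \<phi> \<and>
    (\<forall>i\<le>6. u i \<circ> u i = id) \<and>
    (\<forall>i\<le>6. \<forall>j\<le>6. i \<noteq> j \<longrightarrow> (u i \<circ> u j) ^^ coxeter_D72 i j = id) \<and>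
    \<phi> \<circ> \<phi> = id \<and>
    (\<forall>i\<le>6. \<phi> \<circ> u i \<circ> inv \<phi> = u (6 - i))"
proof (intro exI[of _ u] exI[of _ \<phi>] conjI)
  show "\<forall>i\<le>6. baecklund (u i)"
    using baecklund_u0 baecklund_u1 baecklund_u2 baecklund_u3 baecklund_u4 baecklund_u5 baecklund_u6
    by (auto simp: atMost_6_cases)
  show "\<forall>i\<le>6. \<forall>j\<le>6. i \<noteq> j \<longrightarrow> (u i \<circ> u j) ^^ coxeter_D72 i j = id"
    using coxeter_relations unfolding coxeter_relation_def by blast
  have "inv \<phi> = \<phi>"
    using \<phi>_\<phi> by (metis inv_unique_comp)
  then show "\<forall>i\<le>6. \<phi> \<circ> u i \<circ> inv \<phi> = u (6 - i)"
    by (simp add: \<phi>_u)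
qed (simp_all only: images_u0 images_u1 images_u2 images_u3 images_u4 images_u5 images_u6 images_\<phi>
    baecklund_\<phi> u_u \<phi>_\<phi> simp_thms)

end
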